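(* a) Let $0<p<1/2$, $f\in H_p$ and $$\omega_{H_p}\left(\frac1{M_n},f\right)=o\left(\frac1{M_n^{1/p-2}}\right)\quad\text{when } n\to\infty .$$ Then $\|\sigma_nf-f\|_{H_p}\to0$ when $n\to\infty$. b) Let $0<p<1/2$. Then there exists a martingale $f\in H_p$ for which $$\omega_{H_p}\left(\frac1{M_n},f\right)=O\left(\frac1{M_n^{1/p-2}}\right)\quad\text{when } n\to\infty$$ and $\|\sigma_nf-f\|_{weak-L_p}\nrightarrow0$ when $n\to\infty$.
   Context: $\mathbb N_+$ is the set of positive integers, $\mathbb N=\mathbb N_+\cup\{0\}$. Fix a bounded sequence $m=(m_0,m_1,\dots)$ of integers $m_k\ge 2$. $G_m=\prod_{k\ge0}Z_{m_k}$, where $Z_{m_k}=\{0,\dots,m_k-1\}$ is the additive group modulo $m_k$, with the product of the discrete topologies; $\mu$ is the Haar measure with $\mu(G_m)=1$. $M_0:=1$, $M_{k+1}:=m_kM_k$; every $n\in\mathbb N$ is uniquely $n=\sum_{j\ge0}n_jM_j$ with $n_j\in Z_{m_j}$. $r_k(x):=\exp(2\pi i x_k/m_k)$, $\psi_n:=\prod_{k\ge0}r_k^{n_k}$ (Vilenkin system). $I_0(x):=G_m$, $I_n(x):=\{y: y_0=x_0,\dots,y_{n-1}=x_{n-1}\}$; $\mathcal F_n$ is the $\sigma$-algebra generated by $\{I_n(x):x\in G_m\}$. For $g\in L_1(G_m)$: $\widehat g(k):=\int g\overline{\psi_k}\,d\mu$, $S_ng:=\sum_{k=0}^{n-1}\widehat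 g(k)\psi_k$. A martingale is a sequence $f=(f^{(n)}:n\in\mathbb N)$ of integrable functions with $f^{(n)}$ $\mathcal F_n$-measurable and $S_{M_n}f^{(k)}=f^{(n)}$ for $n\le k$; $f^*:=\sup_n|f^{(n)}|$; $H_p$ is the set of martingales with $\|f\|_{H_p}:=\|f^*\|_p<\infty$, where $\|g\|_p:=(\int|g|^pd\mu)^{1/p}$ for functions. For a martingale, $\widehat f(i):=\lim_k\int f^{(k)}\overline{\psi_i}\,d\mu$, $S_nf:=\sum_{k=0}^{n-1}\widehat f(k)\psi_k$, and $\sigma_nf:=\frac1n\sum_{k=1}^nS_kf$ ($n\in\mathbb N_+$). A function $g\in L_1$ is identified with the martingale $(S_{M_k}g:k\in\mathbb N)$; thus $\sigma_nf-f$ is the martingale $(S_{M_k}\sigma_nf-f^{(k)}:k\in\mathbb N)$, and similarly for $f-S_{M_n}f$. For functions $\|g\|_{weak-L_p}:=\sup_{\lambda>0}\lambda\,\mu(|g|>\lambda)^{1/p}$, and for martingales $\|f\|_{weak-L_p}:=\sup_n\|f^{(n)}\|_{weak-L_p}$. The modulus of continuity in $H_p$ is $\omega_{H_p}(1/M_n,f):=\|f-S_{M_n}f\|_{H_p}$. *)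

theory Defs
  imports "HOL-Probability.Probability"
begin

text \<open>
  The sequence \<open>m\<close> is an explicit parameter of all notions below; the standing assumptions
  on it (bounded, all terms at least 2) are stated where they are used. Points of the Vilenkin group
  are functions \<open>nat \<Rightarrow> nat\<close>; functions on the group are HOL functions of which only
  the values on \<open>vil_group m\<close> matter.
\<close>

definition vil_group :: "(nat \<Rightarrow> nat) \<Rightarrow> (nat \<Rightarrow> nat) set" where
  "vil_group m = (\<Pi>\<^sub>E k\<in>UNIV. {..<m k})"

definition vil_topology :: "(nat \<Rightarrow> nat) \<Rightarrow> (nat \<Rightarrow> nat) topology" where
  "vil_topology m = product_topology (\<lambda>k. discrete_topology {..<m k}) UNIV"

definition vil_add :: "(nat \<Rightarrow> nat) \<Rightarrow> (nat \<Rightarrow> nat) \<Rightarrow> (nat \<Rightarrow> nat) \<Rightarrow> (nat \<Rightarrow> nat)" where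
  "vil_add m x y = (\<lambda>k. (x k + y k) mod m k)"

text \<open>
  The normalised Haar measure, realised as the product of the uniform probability measures. That it
  is a translation-invariant Borel probability measure on the compact group (which determines it) is
  proved in \<open>sets_vil_haar\<close>, \<open>prob_space_vil_haar\<close> and
  \<open>vil_haar_translation_invariant\<close> below.
\<close>

definition vil_haar :: "(nat \<Rightarrow> nat) \<Rightarrow> (nat \<Rightarrow> nat) measure" where
  "vil_haar m = (\<Pi>\<^sub>M k\<in>UNIV. uniform_count_measure {..<m k})"

definition vil_interval :: "(nat \<Rightarrow> nat) \<Rightarrow> nat \<Rightarrow> (nat \<Rightarrow> nat) \<Rightarrow> (nat \<Rightarrow> nat) set" where
  "vil_interval m n x = {y \<in> vil_group m. \<forall>i<n. y i = x i}"

definition vil_filtration :: "(nat \<Rightarrow> nat) \<Rightarrow> nat \<Rightarrow> (nat \<Rightarrow> nat) measure" where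
  "vil_filtration m n = sigma (vil_group m) (vil_interval m n ` vil_group m)"

definition vil_M :: "(nat \<Rightarrow> nat) \<Rightarrow> nat \<Rightarrow> nat" where
  "vil_M m n = (\<Prod>k<n. m k)"

text \<open>The digit \<open>n\<^sub>j\<close> in the expansion \<open>n = (\<Sum>j. n\<^sub>j M\<^sub>j)\<close>; see \<open>vil_digit_unique\<close>.\<close>

definition vil_digit :: "(nat \<Rightarrow> nat) \<Rightarrow> nat \<Rightarrow> nat \<Rightarrow> nat" where
  "vil_digit m n j = (n div vil_M m j) mod m j"

definition rademacher :: "(nat \<Rightarrow> nat) \<Rightarrow> nat \<Rightarrow> (nat \<Rightarrow> nat) \<Rightarrow> complex" where
  "rademacher m k x = exp (2 * complex_of_real pi * \<i> * of_nat (x k) / of_nat (m k))"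

text \<open>Only finitely many factors of the infinite product differ from 1; see \<open>vil_psi_finite\<close>.\<close>

definition vil_psi :: "(nat \<Rightarrow> nat) \<Rightarrow> nat \<Rightarrow> (nat \<Rightarrow> nat) \<Rightarrow> complex" where
  "vil_psi m n x = (\<Prod>k. rademacher m k x ^ vil_digit m n k)"

definition fourier_coeff :: "(nat \<Rightarrow> nat) \<Rightarrow> ((nat \<Rightarrow> nat) \<Rightarrow> complex) \<Rightarrow> nat \<Rightarrow> complex" where
  "fourier_coeff m g k = (LINT x|vil_haar m. g x * cnj (vil_psi m k x))"

definition partial_sum ::
  "(nat \<Rightarrow> nat) \<Rightarrow> nat \<Rightarrow> ((nat \<Rightarrow> nat) \<Rightarrow> complex) \<Rightarrow> (nat \<Rightarrow> nat) \<Rightarrow> complex" where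
  "partial_sum m n g x = (\<Sum>k<n. fourier_coeff m g k * vil_psi m k x)"

type_synonym mart = "nat \<Rightarrow> (nat \<Rightarrow> nat) \<Rightarrow> complex"

definition is_martingale :: "(nat \<Rightarrow> nat) \<Rightarrow> mart \<Rightarrow> bool" where
  "is_martingale m f \<longleftrightarrow>
     (\<forall>n. integrable (vil_haar m) (f n)) \<and>
     (\<forall>n. f n \<in> borel_measurable (vil_filtration m n)) \<and>
     (\<forall>n k. n \<le> k \<longrightarrow> (\<forall>x\<in>vil_group m. partial_sum m (vil_M m n) (f k) x = f n x))"

definition mart_of_fun :: "(nat \<Rightarrow> nat) \<Rightarrow> ((nat \<Rightarrow> nat) \<Rightarrow> complex) \<Rightarrow> mart" where
  "mart_of_fun m g = (\<lambda>k. partial_sum m (vil_M m k) g)"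

definition mart_diff :: "mart \<Rightarrow> mart \<Rightarrow> mart" where
  "mart_diff f g = (\<lambda>k x. f k x - g k x)"

definition mart_coeff :: "(nat \<Rightarrow> nat) \<Rightarrow> mart \<Rightarrow> nat \<Rightarrow> complex" where
  "mart_coeff m f i = lim (\<lambda>k. fourier_coeff m (f k) i)"

definition mart_partial_sum ::
  "(nat \<Rightarrow> nat) \<Rightarrow> nat \<Rightarrow> mart \<Rightarrow> (nat \<Rightarrow> nat) \<Rightarrow> complex" where
  "mart_partial_sum m n f x = (\<Sum>k<n. mart_coeff m f k * vil_psi m k x)"

definition mart_fejer ::
  "(nat \<Rightarrow> nat) \<Rightarrow> nat \<Rightarrow> mart \<Rightarrow> (nat \<Rightarrow> nat) \<Rightarrow> complex" where
  "mart_fejer m n f x = (\<Sum>k=1..n. mart_partial_sum m k f x) / of_nat n"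

text \<open>Only meaningful as the power \<open>x\<^sup>p\<close> for \<open>p > 0\<close>.\<close>

definition ennreal_powr :: "ennreal \<Rightarrow> real \<Rightarrow> ennreal" where
  "ennreal_powr x p = (if x = \<infinity> then \<infinity> else ennreal (enn2real x powr p))"

text \<open>The argument \<open>g\<close> stands for the absolute value of the function measured.\<close>

definition Lp_norm :: "(nat \<Rightarrow> nat) \<Rightarrow> real \<Rightarrow> ((nat \<Rightarrow> nat) \<Rightarrow> ennreal) \<Rightarrow> ennreal" where
  "Lp_norm m p g = ennreal_powr (\<integral>\<^sup>+x. ennreal_powr (g x) p \<partial>vil_haar m) (1 / p)"

definition weak_Lp_norm :: "(nat \<Rightarrow> nat) \<Rightarrow> real \<Rightarrow> ((nat \<Rightarrow> nat) \<Rightarrow> complex) \<Rightarrow> ennreal" where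
  "weak_Lp_norm m p g =
     (SUP l\<in>{0<..}. ennreal l *
        ennreal_powr (emeasure (vil_haar m) {x \<in> space (vil_haar m). l < cmod (g x)}) (1 / p))"

definition maximal_fun :: "mart \<Rightarrow> (nat \<Rightarrow> nat) \<Rightarrow> ennreal" where
  "maximal_fun f x = (SUP n. ennreal (cmod (f n x)))"

definition Hp_norm :: "(nat \<Rightarrow> nat) \<Rightarrow> real \<Rightarrow> mart \<Rightarrow> ennreal" where
  "Hp_norm m p f = Lp_norm m p (maximal_fun f)"

definition Hp :: "(nat \<Rightarrow> nat) \<Rightarrow> real \<Rightarrow> mart set" where
  "Hp m p = {f. is_martingale m f \<and> Hp_norm m p f < \<infinity>}"

definition mart_weak_Lp_norm :: "(nat \<Rightarrow> nat) \<Rightarrow> real \<Rightarrow> mart \<Rightarrow> ennreal" where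
  "mart_weak_Lp_norm m p f = (SUP n. weak_Lp_norm m p (f n))"

text \<open>
  \<open>Hp_modulus m p n f\<close> is the modulus of continuity at \<open>1 / M\<^sub>n\<close>. Here and in
  \<open>fejer_error\<close> a function \<open>g\<close> is identified with the martingale
  \<open>mart_of_fun m g\<close> before subtracting.
\<close>

definition Hp_modulus :: "(nat \<Rightarrow> nat) \<Rightarrow> real \<Rightarrow> nat \<Rightarrow> mart \<Rightarrow> ennreal" where
  "Hp_modulus m p n f =
     Hp_norm m p (mart_diff f (mart_of_fun m (mart_partial_sum m (vil_M m n) f)))"

definition fejer_error :: "(nat \<Rightarrow> nat) \<Rightarrow> nat \<Rightarrow> mart \<Rightarrow> mart" where
  "fejer_error m n f = mart_diff (mart_of_fun m (mart_fejer m n f)) f"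

text \<open>
  Landau symbols for an extended-real-valued left-hand side. They unfold as in
  \<open>Landau_Symbols\<close>, whose versions need a normed field and hence finite values.
\<close>

definition enn_smallo :: "(nat \<Rightarrow> ennreal) \<Rightarrow> (nat \<Rightarrow> real) \<Rightarrow> bool" where
  "enn_smallo a b \<longleftrightarrow> (\<forall>c>0. eventually (\<lambda>n. a n \<le> ennreal (c * \<bar>b n\<bar>)) sequentially)"

definition enn_bigo :: "(nat \<Rightarrow> ennreal) \<Rightarrow> (nat \<Rightarrow> real) \<Rightarrow> bool" where
  "enn_bigo a b \<longleftrightarrow> (\<exists>c>0. eventually (\<lambda>n. a n \<le> ennreal (c * \<bar>b n\<bar>)) sequentially)"

lemma space_vil_haar: "space (vil_haar m) = vil_group m"
  by (simp add: vil_haar_def vil_group_def space_PiM space_uniform_count_measure)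

lemma topspace_vil_topology: "topspace (vil_topology m) = vil_group m"
  by (simp add: vil_topology_def vil_group_def)

lemma vil_interval_in_sets: "vil_interval m n x \<in> sets (vil_haar m)"
proof -
  have comp: "(\<lambda>y. y i) \<in> measurable (vil_haar m) (count_space UNIV)" for i
  proof -
    have "(\<lambda>y. y i) \<in> measurable (vil_haar m) (uniform_count_measure {..<m i})"
      unfolding vil_haar_def by (rule measurable_component_singleton) simp
    then have "(\<lambda>y. y i) \<in> measurable (vil_haar m) (count_space {..<m i})"
      by (simp only: measurable_cong_sets[OF refl sets_uniform_count_measure_count_space])
    then show ?thesis
      by (rule measurable_compose) simp
  qed
  have "{y \<in> space (vil_haar m). \<forall>i\<in>{..<n}. y i = x i} \<in> sets (vil_haar m)"
  proof (rule sets.sets_Collect_finite_All)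
    fix i
    have "(\<lambda>y. y i) -` {x i} \<inter> space (vil_haar m) \<in> sets (vil_haar m)"
      by (rule measurable_sets[OF comp]) simp
    moreover have "(\<lambda>y. y i) -` {x i} \<inter> space (vil_haar m) = {y \<in> space (vil_haar m). y i = x i}"
      by auto
    ultimately show "{y \<in> space (vil_haar m). y i = x i} \<in> sets (vil_haar m)" by simp
  qed simp
  also have "{y \<in> space (vil_haar m). \<forall>i\<in>{..<n}. y i = x i} = vil_interval m n x"
    unfolding vil_interval_def space_vil_haar by blast
  finally show ?thesis .
qed

lemma open_vil_interval:
  assumes "openin (vil_topology m) U" "x \<in> U"
  shows "\<exists>n. vil_interval m n x \<subseteq> U"
proof -
  obtain V where fin: "finite {i. V i \<noteq> {..<m i}}"
    and x: "x \<in> Pi\<^sub>E UNIV V" and sub: "Pi\<^sub>E UNIV V \<subseteq> U"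
    using assms unfolding vil_topology_def openin_product_topology_alt by auto
  obtain n where n: "\<forall>i\<in>{i. V i \<noteq> {..<m i}}. i < n"
    using fin finite_nat_set_iff_bounded by blast
  have "vil_interval m n x \<subseteq> Pi\<^sub>E UNIV V"
  proof
    fix y assume y: "y \<in> vil_interval m n x"
    have "y i \<in> V i" for i
    proof (cases "V i = {..<m i}")
      case True
      with y show ?thesis by (auto simp: vil_interval_def vil_group_def PiE_iff)
    next
      case False
      with n y have "y i = x i" by (auto simp: vil_interval_def)
      with x show ?thesis by (auto simp: PiE_iff)
    qed
    then show "y \<in> Pi\<^sub>E UNIV V" by auto
  qed
  with sub show ?thesis by blast
qed

lemma sets_vil_haar: "sets (vil_haar m) = sigma_sets (vil_group m) {U. openin (vil_topology m) U}"
proof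
  show "sets (vil_haar m) \<subseteq> sigma_sets (vil_group m) {U. openin (vil_topology m) U}"
    unfolding vil_haar_def sets_PiM_single
    unfolding space_uniform_count_measure sets_uniform_count_measure vil_group_def[symmetric]
  proof (rule sigma_sets_mono', safe)
    fix i A assume A: "A \<subseteq> {..<m i}"
    have "openin (vil_topology m) {x \<in> topspace (vil_topology m). x i \<in> A}"
      unfolding vil_topology_def
      by (rule openin_continuous_map_preimage[OF continuous_map_product_projection]) (use A in auto)
    then show "openin (vil_topology m) {f \<in> vil_group m. f i \<in> A}"
      by (simp add: topspace_vil_topology)
  qed
next
  have "U \<in> sets (vil_haar m)" if U: "openin (vil_topology m) U" for U
  proof -
    let ?C = "{I. I \<subseteq> U \<and> (\<exists>n x. I = vil_interval m n x)}"
    define J where "J l = {y \<in> vil_group m. \<forall>i<length l. y i = l ! i}" for l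
    have "vil_interval m n x = J (map x [0..<n])" for n x
      by (auto simp: vil_interval_def J_def)
    then have "?C \<subseteq> range J" by auto
    then have "countable ?C"
      by (rule countable_subset) simp
    moreover have "?C \<subseteq> sets (vil_haar m)"
      using vil_interval_in_sets by auto
    ultimately have "\<Union>?C \<in> sets (vil_haar m)"
      by (rule sets.countable_Union)
    moreover have "U \<subseteq> \<Union>?C"
    proof
      fix x assume x: "x \<in> U"
      with U have "x \<in> vil_group m"
        using openin_subset topspace_vil_topology by blast
      then have "x \<in> vil_interval m n x" for n by (simp add: vil_interval_def)
      with open_vil_interval[OF U x] show "x \<in> \<Union>?C" by blast
    qed
    moreover have "\<Union>?C \<subseteq> U" by blast
    ultimately show ?thesis by (metis (no_types, lifting) subset_antisym)
  qed
  then have "{U. openin (vil_topology m) U} \<subseteq> sets (vil_haar m)" by blast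
  from sets.sigma_sets_subset[OF this]
  show "sigma_sets (vil_group m) {U. openin (vil_topology m) U} \<subseteq> sets (vil_haar m)"
    by (simp only: space_vil_haar)
qed

lemma prob_space_vil_haar:
  assumes "\<forall>k. 2 \<le> m k"
  shows "prob_space (vil_haar m)"
  unfolding vil_haar_def
proof (rule prob_space_PiM)
  fix i
  have "0 < m i" using assms[rule_format, of i] by simp
  then show "prob_space (uniform_count_measure {..<m i})"
    by (intro prob_space_uniform_count_measure) auto
qed

lemma bij_betw_shift_mod:
  fixes a k :: nat
  assumes "0 < k"
  shows "bij_betw (\<lambda>y. (a + y) mod k) {..<k} {..<k}"
proof -
  have "inj_on (\<lambda>y. (a + y) mod k) {..<k}"
  proof (rule inj_onI)
    have le: "z \<le> y" if "z < k" "(a + y) mod k = (a + z) mod k" for y z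
    proof (rule ccontr)
      assume "\<not> z \<le> y"
      then have "k dvd (a + z) - (a + y)"
        using that(2) mod_eq_dvd_iff_nat[of "a + y" "a + z" k] by simp
      then have "k dvd z - y" by simp
      with \<open>\<not> z \<le> y\<close> have "k \<le> z - y" by (intro dvd_imp_le) auto
      with \<open>z < k\<close> \<open>\<not> z \<le> y\<close> show False by simp
    qed
    fix y z assume "y \<in> {..<k}" "z \<in> {..<k}" "(a + y) mod k = (a + z) mod k"
    then show "y = z" using le[of y z] le[of z y] by simp
  qed
  moreover have "(\<lambda>y. (a + y) mod k) ` {..<k} \<subseteq> {..<k}" using assms by auto
  ultimately show ?thesis
    by (simp add: bij_betw_def endo_inj_surj)
qed

lemma vil_haar_translation_invariant:
  assumes m: "\<forall>k. 2 \<le> m k"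
  shows "vil_add m a \<in> measurable (vil_haar m) (vil_haar m)"
    and "distr (vil_haar m) (vil_haar m) (vil_add m a) = vil_haar m"
proof -
  let ?U = "\<lambda>k. uniform_count_measure {..<m k}"
  have pos: "0 < m k" for k using m[rule_format, of k] by simp
  have ps: "prob_space (?U k)" for k
    using pos by (intro prob_space_uniform_count_measure) auto
  interpret P: product_prob_space ?U UNIV
    using ps by (auto simp: product_prob_space_def product_prob_space_axioms_def
        product_sigma_finite_def prob_space_imp_sigma_finite)
  have meas: "(\<lambda>x. \<lambda>k. (a k + x k) mod m k) \<in> measurable (PiM UNIV ?U) (PiM UNIV ?U)"
  proof (rule measurable_PiM_single')
    fix i :: nat
    have 1: "(\<lambda>x. x i) \<in> measurable (PiM UNIV ?U) (?U i)"
      by (rule measurable_component_singleton) simp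
    have 2: "(\<lambda>y. (a i + y) mod m i) \<in> measurable (?U i) (?U i)"
      using pos by (auto simp: measurable_def sets_uniform_count_measure space_uniform_count_measure)
    show "(\<lambda>x. (a i + x i) mod m i) \<in> measurable (PiM UNIV ?U) (?U i)"
      using measurable_compose[OF 1 2] .
  next
    show "(\<lambda>x k. (a k + x k) mod m k) \<in> space (PiM UNIV ?U) \<rightarrow> (\<Pi>\<^sub>E i\<in>UNIV. space (?U i))"
      using pos by (auto simp: space_uniform_count_measure)
  qed
  then show M: "vil_add m a \<in> measurable (vil_haar m) (vil_haar m)"
    by (simp add: vil_add_def[abs_def] vil_haar_def)
  have "vil_haar m = distr (vil_haar m) (vil_haar m) (vil_add m a)"
    unfolding vil_haar_def
  proof (rule measure_eqI_PiM_infinite[where I = UNIV and M = ?U])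
    fix A J assume J: "finite J" "J \<subseteq> (UNIV :: nat set)"
      and A: "\<And>i. i \<in> J \<Longrightarrow> A i \<in> sets (?U i)"
    let ?B = "\<lambda>i. {y \<in> {..<m i}. (a i + y) mod m i \<in> A i}"
    have A': "A i \<subseteq> {..<m i}" if "i \<in> J" for i
      using A[OF that] by (simp add: sets_uniform_count_measure)
    have card: "card (?B i) = card (A i)" if "i \<in> J" for i
    proof -
      have bij: "bij_betw (\<lambda>y. (a i + y) mod m i) {..<m i} {..<m i}"
        using bij_betw_shift_mod[OF pos] .
      have "A i \<subseteq> (\<lambda>y. (a i + y) mod m i) ` {..<m i}"
        using bij A'[OF that] by (simp add: bij_betw_def)
      then have img: "(\<lambda>y. (a i + y) mod m i) ` ?B i = A i"
        by blast
      have "inj_on (\<lambda>y. (a i + y) mod m i) (?B i)"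
        using bij_betw_imp_inj_on[OF bij] by (rule inj_on_subset) blast
      from card_image[OF this] show ?thesis unfolding img by simp
    qed
    have em: "emeasure (?U i) (?B i) = emeasure (?U i) (A i)" if "i \<in> J" for i
      using A'[OF that] card[OF that] by (subst (1 2) emeasure_uniform_count_measure) auto
    have vim: "vil_add m a -` prod_emb UNIV ?U J (Pi\<^sub>E J A) \<inter> space (PiM UNIV ?U)
        = prod_emb UNIV ?U J (Pi\<^sub>E J ?B)"
      using pos by (auto simp: vil_add_def prod_emb_def space_PiM space_uniform_count_measure
          PiE_iff Pi_iff)
    have "emeasure (distr (PiM UNIV ?U) (PiM UNIV ?U) (vil_add m a)) (prod_emb UNIV ?U J (Pi\<^sub>E J A))
        = emeasure (PiM UNIV ?U) (prod_emb UNIV ?U J (Pi\<^sub>E J ?B))"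
      using M J A by (subst emeasure_distr) (auto simp: vil_haar_def vim intro!: sets_PiM_I)
    also have "\<dots> = (\<Prod>i\<in>J. emeasure (?U i) (?B i))"
      using J by (intro P.emeasure_PiM_emb) (auto simp: sets_uniform_count_measure)
    also have "\<dots> = (\<Prod>i\<in>J. emeasure (?U i) (A i))"
      using em by (rule prod.cong[OF refl])
    also have "\<dots> = emeasure (PiM UNIV ?U) (prod_emb UNIV ?U J (Pi\<^sub>E J A))"
      using J A by (intro P.emeasure_PiM_emb[symmetric]) auto
    finally show "emeasure (PiM UNIV ?U) (prod_emb UNIV ?U J (Pi\<^sub>E J A))
      = emeasure (distr (PiM UNIV ?U) (PiM UNIV ?U) (vil_add m a)) (prod_emb UNIV ?U J (Pi\<^sub>E J A))" ..
  next
    show "finite_measure (PiM UNIV ?U)"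
      by (simp add: P.P.finite_measure_axioms)
  qed simp_all
  then show "distr (vil_haar m) (vil_haar m) (vil_add m a) = vil_haar m" ..
qed

lemma vil_M_simps: "vil_M m 0 = 1" "vil_M m (Suc k) = m k * vil_M m k"
  by (simp_all add: vil_M_def)

lemma vil_M_gt:
  assumes "\<forall>k. 2 \<le> m k"
  shows "n < vil_M m n"
proof (induction n)
  case (Suc n)
  have "Suc n \<le> vil_M m n" using Suc by simp
  moreover have "2 * vil_M m n \<le> m n * vil_M m n"
    using assms by (intro mult_right_mono) auto
  ultimately have "Suc n < m n * vil_M m n" by linarith
  then show ?case by (simp add: vil_M_simps)
qed (simp add: vil_M_simps)

lemma vil_digit_eq_0:
  assumes "\<forall>k. 2 \<le> m k" "n \<le> j"
  shows "vil_digit m n j = 0"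
  using vil_M_gt[OF assms(1), of j] assms(2) by (simp add: vil_digit_def)

lemma vil_digit_less:
  assumes "\<forall>k. 2 \<le> m k"
  shows "vil_digit m n j < m j"
  using assms[rule_format, of j] by (simp add: vil_digit_def)

lemma vil_sum_less:
  assumes "\<forall>j. d j < m j"
  shows "(\<Sum>j<k. d j * vil_M m j) < vil_M m k"
proof (induction k)
  case (Suc k)
  have "Suc (d k) * vil_M m k \<le> m k * vil_M m k"
    using assms by (intro mult_right_mono) (auto simp: Suc_le_eq)
  then show ?case using Suc by (simp add: vil_M_simps)
qed (simp add: vil_M_simps)

lemma vil_digit_partial: "(\<Sum>j<k. vil_digit m n j * vil_M m j) = n mod vil_M m k"
proof (induction k)
  case (Suc k)
  have "n mod (vil_M m k * m k) = vil_M m k * (n div vil_M m k mod m k) + n mod vil_M m k"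
    by (rule mod_mult2_eq)
  then show ?case using Suc by (simp add: vil_M_simps vil_digit_def mult.commute)
qed (simp add: vil_M_simps)

lemma vil_digit_unique:
  assumes m: "\<forall>k. 2 \<le> m k" and d: "\<forall>j. d j < m j" and fin: "finite {j. d j \<noteq> 0}"
  shows "n = (\<Sum>j | d j \<noteq> 0. d j * vil_M m j) \<longleftrightarrow> d = vil_digit m n"
proof -
  have full: "(\<Sum>j | e j \<noteq> 0. e j * vil_M m j) = (\<Sum>j<k. e j * vil_M m j)"
    if "\<forall>j\<ge>k. e j = 0" for e k
    by (rule sum.mono_neutral_left) (use that in \<open>auto simp: not_less[symmetric]\<close>)
  show ?thesis
  proof
    assume n: "n = (\<Sum>j | d j \<noteq> 0. d j * vil_M m j)"
    have split: "\<exists>q. n = (\<Sum>j<Suc k. d j * vil_M m j) + q * vil_M m (Suc k)" for k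
    proof -
      have dv: "vil_M m (Suc k) dvd vil_M m j" if "Suc k \<le> j" for j
        unfolding vil_M_def by (rule prod_dvd_prod_subset) (use that in auto)
      have "n = (\<Sum>j\<in>{j. d j \<noteq> 0} \<inter> {..<Suc k}. d j * vil_M m j)
              + (\<Sum>j\<in>{j. d j \<noteq> 0} - {..<Suc k}. d j * vil_M m j)"
        unfolding n using sum.Int_Diff[OF fin] .
      moreover have "(\<Sum>j\<in>{j. d j \<noteq> 0} \<inter> {..<Suc k}. d j * vil_M m j)
          = (\<Sum>j<Suc k. d j * vil_M m j)"
        by (rule sum.mono_neutral_left) auto
      moreover have "vil_M m (Suc k) dvd (\<Sum>j\<in>{j. d j \<noteq> 0} - {..<Suc k}. d j * vil_M m j)"
        by (rule dvd_sum) (auto intro!: dvd_mult dv)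
      ultimately show ?thesis by (metis dvd_def mult.commute)
    qed
    show "d = vil_digit m n"
    proof
      fix k
      obtain q where q: "n = (\<Sum>j<Suc k. d j * vil_M m j) + q * vil_M m (Suc k)"
        using split by blast
      have lt: "(\<Sum>j<k. d j * vil_M m j) < vil_M m k" by (rule vil_sum_less[OF d])
      have "n = (\<Sum>j<k. d j * vil_M m j) + vil_M m k * (d k + q * m k)"
        using q by (simp add: vil_M_simps algebra_simps)
      then have "n div vil_M m k = d k + q * m k"
        using lt by simp
      then show "d k = vil_digit m n k" using d by (simp add: vil_digit_def)
    qed
  next
    assume dd: "d = vil_digit m n"
    have "(\<Sum>j | d j \<noteq> 0. d j * vil_M m j) = (\<Sum>j<n. d j * vil_M m j)"
      by (rule full) (use dd vil_digit_eq_0[OF m] in auto)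
    also have "\<dots> = n" using dd vil_digit_partial[of m n n] vil_M_gt[OF m, of n] by simp
    finally show "n = (\<Sum>j | d j \<noteq> 0. d j * vil_M m j)" ..
  qed
qed

lemma vil_psi_finite:
  assumes "\<forall>k. 2 \<le> m k"
  shows "vil_psi m n x = (\<Prod>k<n. rademacher m k x ^ vil_digit m n k)"
  unfolding vil_psi_def
  by (rule prodinf_finite) (use vil_digit_eq_0[OF assms] in auto)

end

theory Submission
  imports Defs
begin

text \<open>
  A martingale is determined by its Fourier coefficients \<open>c\<close>, and \<open>\<sigma>\<^sub>n f - f\<close>
  has the coefficients \<open>- min i n / n * c i\<close>. Cut it into the blocks
  \<open>M\<^sub>k \<le> i < M\<^sub>k\<^sub>+\<^sub>1\<close>. A block is constant on the cosets of level \<open>k + 1\<close>, so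
  convolution with \<open>n K\<^sub>n\<close> is a finite sum, to which \<open>(a + b)\<^sup>p \<le> a\<^sup>p + b\<^sup>p\<close>
  applies; hence no atomic decomposition is needed, only that \<open>n K\<^sub>n\<close> is bounded in \<open>L\<^sub>p\<close> uniformly
  in \<open>n\<close>. The latter follows by recursion over the digits of \<open>n\<close> and uses
  \<open>p < 1/2\<close>. The Fejer error of the \<open>k\<close>-th block is thus at most
  \<open>C (M\<^sub>k\<^sub>+\<^sub>1 / n)\<^sup>p M\<^sub>k\<^bsup>1 - 2p\<^esup>\<close> times the \<open>p\<close>-th power of the norm of the block, and under
  the little-o condition the sum over \<open>k\<close> is a convolution of a null sequence with a geometric one.

  For b), let \<open>c i = M\<^sub>k\<close> on the \<open>k\<close>-th block. Off a set of measure \<open>1 / M\<^sub>N\<close> the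
  martingales \<open>(M\<^sub>N + 1) (\<sigma> f - f)\<close> for the index \<open>M\<^sub>N + 1\<close> and
  \<open>M\<^sub>N (\<sigma> f - f)\<close> for the index \<open>M\<^sub>N\<close> differ at level \<open>N + 1\<close> by
  \<open>M\<^sub>N \<psi>\<close> with \<open>\<psi>\<close> a unimodular character, so both cannot be small in measure.
\<close>

section \<open>Powers with exponent at most 1, extended-real powers and null sequences\<close>

lemma powr_add_le:
  fixes a b p :: real
  assumes "0 \<le> a" "0 \<le> b" "0 < p" "p \<le> 1"
  shows "(a + b) powr p \<le> a powr p + b powr p"
proof (cases "a + b = 0")
  case False
  with assms have s: "a + b > 0" by simp
  \<comment> \<open>Dividing by \<open>a + b\<close> leaves two numbers in the unit interval with
    sum 1; there, lowering the exponent from 1 to \<open>p\<close> does not decrease a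
    number.\<close>
  have *: "t \<le> t powr p" if "0 \<le> t" "t \<le> 1" for t :: real
    using that assms powr_mono'[of p 1 t] by (cases "t = 0") auto
  have "1 = a / (a + b) + b / (a + b)"
    using False by (simp add: add_divide_distrib[symmetric])
  also have "\<dots> \<le> (a / (a + b)) powr p + (b / (a + b)) powr p"
    using s assms by (intro add_mono *) auto
  also have "\<dots> = (a powr p + b powr p) / (a + b) powr p"
    using assms s by (simp add: powr_divide add_divide_distrib)
  finally show ?thesis using s by (simp add: field_simps)
qed (use assms in auto)

lemma powr_sum_le:
  fixes f :: "'a \<Rightarrow> real" and p :: real
  assumes "\<And>i. i \<in> A \<Longrightarrow> 0 \<le> f i" "0 < p" "p \<le> 1"
  shows "(\<Sum>i\<in>A. f i) powr p \<le> (\<Sum>i\<in>A. f i powr p)"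
  using assms(1)
proof (induction A rule: infinite_finite_induct)
  case (insert x A)
  have "(f x + sum f A) powr p \<le> f x powr p + sum f A powr p"
    using insert assms by (intro powr_add_le sum_nonneg) auto
  with insert show ?case by simp
qed (use assms in auto)

lemma sum_lessThan_mult:
  fixes f :: "nat \<Rightarrow> 'a::comm_monoid_add"
  shows "(\<Sum>l<k * n. f l) = (\<Sum>j<k. \<Sum>i<n. f (j * n + i))"
proof -
  have "(\<Sum>l<k * n. f l) = (\<Sum>j<k. \<Sum>l\<in>{j * n..<j * n + n}. f l)"
    by (rule sum.nat_group[symmetric])
  also have "\<dots> = (\<Sum>j<k. \<Sum>i<n. f (j * n + i))"
  proof (rule sum.cong[OF refl])
    fix j
    show "(\<Sum>l\<in>{j * n..<j * n + n}. f l) = (\<Sum>i<n. f (j * n + i))"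
      using sum.shift_bounds_nat_ivl[of f 0 "j * n" n]
      by (simp add: add.commute lessThan_atLeast0)
  qed
  finally show ?thesis .
qed

lemma ennreal_powr_ennreal: "0 \<le> a \<Longrightarrow> ennreal_powr (ennreal a) p = ennreal (a powr p)"
  by (simp add: ennreal_powr_def)

lemma ennreal_powr_mono:
  assumes "x \<le> y" "0 < p"
  shows "ennreal_powr x p \<le> ennreal_powr y p"
proof (cases "y = \<infinity>")
  case False
  with assms(1) have "y < top" by (simp add: top.not_eq_extremum)
  with assms have "x \<noteq> \<infinity>" "enn2real x \<le> enn2real y"
    by (auto intro: enn2real_mono)
  with False assms show ?thesis
    by (simp add: ennreal_powr_def ennreal_leI powr_mono2)
qed (simp add: ennreal_powr_def)

lemma ennreal_powr_powr_inverse: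
  assumes "0 < p"
  shows "ennreal_powr (ennreal_powr x p) (1 / p) = x" "ennreal_powr (ennreal_powr x (1 / p)) p = x"
  using assms by (auto simp: ennreal_powr_def powr_powr top.not_eq_extremum)

lemma ennreal_powr_le_iff:
  assumes "0 < p"
  shows "ennreal_powr x p \<le> y \<longleftrightarrow> x \<le> ennreal_powr y (1 / p)"
  using ennreal_powr_mono[of "ennreal_powr x p" y "1 / p"] ennreal_powr_mono[of x "ennreal_powr y (1 / p)" p]
  by (auto simp: ennreal_powr_powr_inverse[OF assms] assms)

text \<open>Taking \<open>p\<close>-th powers is an order isomorphism, so the power moves to the
  side of \<open>y\<close> and the supremum is then bounded termwise.\<close>

lemma ennreal_powr_SUP_le:
  assumes "0 < p" "\<And>n. ennreal_powr (a n) p \<le> y"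
  shows "ennreal_powr (SUP n. a n) p \<le> y"
  using assms(2) unfolding ennreal_powr_le_iff[OF assms(1)] by (intro SUP_least)

lemma borel_measurable_ennreal_powr [measurable]:
  assumes [measurable]: "f \<in> borel_measurable N"
  shows "(\<lambda>x. ennreal_powr (f x) p) \<in> borel_measurable N"
  unfolding ennreal_powr_def by measurable

lemma sum_lessThan_add:
  fixes f :: "nat \<Rightarrow> 'a::comm_monoid_add"
  shows "(\<Sum>l<a + b. f l) = (\<Sum>l<a. f l) + (\<Sum>l<b. f (a + l))"
  by (induction b) (simp_all add: add.assoc)

lemma ennreal_tendsto_0I:
  fixes X :: "nat \<Rightarrow> ennreal"
  assumes "\<And>e. 0 < e \<Longrightarrow> eventually (\<lambda>n. X n \<le> ennreal e) sequentially"
  shows "X \<longlonglongrightarrow> 0"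
proof (rule order_tendstoI)
  fix a :: ennreal assume "0 < a"
  \<comment> \<open>The bound \<open>a\<close> may be infinite; an intermediate \<open>b\<close> is
    finite and also turns the weak inequality into a strict one.\<close>
  then obtain b where b: "0 < b" "b < a" using dense by blast
  then have "b \<noteq> top" by auto
  with b(1) obtain e where e: "b = ennreal e" "0 < e"
    by (cases b) auto
  from assms[OF e(2)] show "eventually (\<lambda>n. X n < a) sequentially"
    by eventually_elim (use b e in \<open>auto intro: le_less_trans\<close>)
qed simp

lemma tendsto_0_recurrence:
  fixes a e :: "nat \<Rightarrow> real" and q :: real
  assumes a: "\<And>n. a (Suc n) = q * a n + e (Suc n)" and q: "0 \<le> q" "q < 1" and e: "e \<longlonglongrightarrow> 0"
  shows "a \<longlonglongrightarrow> 0"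
proof (rule LIMSEQ_I)
  fix r :: real assume r: "0 < r"
  \<comment> \<open>This threshold makes \<open>r / 2\<close> the fixed point of
    \<open>\<lambda>t. q * t + r / 2 * (1 - q)\<close>, so that only the contribution of
    \<open>a n0\<close>, which decays like \<open>q ^ j\<close>, remains to be controlled.\<close>
  have "0 < r / 2 * (1 - q)" using r q by simp
  then obtain n0 where n0: "\<And>n. n \<ge> n0 \<Longrightarrow> \<bar>e n\<bar> < r / 2 * (1 - q)"
    using LIMSEQ_D[OF e] by fastforce
  have bound: "\<bar>a (n0 + j)\<bar> \<le> q ^ j * \<bar>a n0\<bar> + r / 2" for j
  proof (induction j)
    case (Suc j)
    have "\<bar>a (n0 + Suc j)\<bar> \<le> q * \<bar>a (n0 + j)\<bar> + \<bar>e (Suc (n0 + j))\<bar>"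
      using q abs_triangle_ineq[of "q * a (n0 + j)" "e (Suc (n0 + j))"] by (simp add: a abs_mult)
    also have "\<dots> \<le> q * (q ^ j * \<bar>a n0\<bar> + r / 2) + r / 2 * (1 - q)"
      using Suc n0[of "Suc (n0 + j)"] q by (intro add_mono mult_left_mono) auto
    also have "\<dots> = q ^ Suc j * \<bar>a n0\<bar> + r / 2" by (simp add: field_simps)
    finally show ?case .
  qed (use r in simp)
  have "(\<lambda>j. q ^ j * \<bar>a n0\<bar>) \<longlonglongrightarrow> 0 * \<bar>a n0\<bar>"
    using q by (intro tendsto_intros LIMSEQ_power_zero) auto
  then obtain j0 where j0: "\<And>j. j \<ge> j0 \<Longrightarrow> \<bar>q ^ j * \<bar>a n0\<bar>\<bar> < r / 2"
    using LIMSEQ_D[of _ 0 "r / 2"] r by fastforce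
  show "\<exists>no. \<forall>n\<ge>no. norm (a n - 0) < r"
  proof (intro exI allI impI)
    fix n assume n: "n \<ge> n0 + j0"
    then have "n = n0 + (n - n0)" "n - n0 \<ge> j0" by auto
    with bound[of "n - n0"] j0[of "n - n0"] show "norm (a n - 0) < r" by auto
  qed
qed

lemma tendsto_0_geometric_convolution:
  fixes e :: "nat \<Rightarrow> real"
  assumes "e \<longlonglongrightarrow> 0" "0 \<le> q" "q < 1"
  shows "(\<lambda>N. \<Sum>k<Suc N. q ^ (N - k) * e k) \<longlonglongrightarrow> 0"
proof (rule tendsto_0_recurrence[OF _ assms(2,3,1)])
  fix N
  have "(\<Sum>k<Suc N. q ^ (Suc N - k) * e k) = q * (\<Sum>k<Suc N. q ^ (N - k) * e k)"
    unfolding sum_distrib_left by (intro sum.cong refl) (simp add: Suc_diff_le less_Suc_eq_le)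
  then show "(\<Sum>k<Suc (Suc N). q ^ (Suc N - k) * e k) = q * (\<Sum>k<Suc N. q ^ (N - k) * e k) + e (Suc N)"
    by simp
qed

subsection \<open>Integration of functions of finitely many coordinates\<close>

locale vilenkin =
  fixes m :: "nat \<Rightarrow> nat" and B :: nat
  assumes m_ge_2: "2 \<le> m k" and m_le: "m k \<le> B"
begin

abbreviation "M \<equiv> vil_M m"
abbreviation "\<psi> \<equiv> vil_psi m"
abbreviation "G \<equiv> vil_group m"
abbreviation "\<mu> \<equiv> vil_haar m"
text \<open>The digit sequence of \<open>u\<close>, read as a point of the group. For
  \<open>u < M N\<close> these points represent each coset of level \<open>N\<close> exactly once,
  so integrals become sums over \<open>u\<close>.\<close>

abbreviation "pt \<equiv> vil_digit m"

lemma m_all: "\<forall>k. 2 \<le> m k" by (simp add: m_ge_2)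

lemma m_pos: "0 < m k" using m_ge_2[of k] by simp

lemma B_ge_2: "2 \<le> B" using m_ge_2[of 0] m_le[of 0] by simp

lemma M_pos: "0 < M n" by (simp add: vil_M_def m_pos prod_pos)

lemma M_ge_1: "1 \<le> M n" using M_pos[of n] by simp

lemma M_Suc_le: "M (Suc n) \<le> B * M n"
  by (simp add: vil_M_simps m_le)

lemma M_Suc_ge: "2 * M n \<le> M (Suc n)"
  by (simp add: vil_M_simps m_ge_2)

lemma M_mono: "i \<le> j \<Longrightarrow> M i \<le> M j"
proof (erule lift_Suc_mono_le[rotated])
  show "M n \<le> M (Suc n)" for n using M_Suc_ge[of n] by linarith
qed

lemma M_add_ge: "2 ^ j * M i \<le> M (i + j)"
proof (induction j)
  case (Suc j)
  have "2 ^ Suc j * M i \<le> 2 * M (i + j)" using Suc by simp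
  also have "\<dots> \<le> M (i + Suc j)" using M_Suc_ge[of "i + j"] by simp
  finally show ?case .
qed simp

section \<open>Mixed-radix digits and coset representatives\<close>

lemma pt_in_G: "pt u \<in> G"
  by (auto simp: vil_group_def vil_digit_less[OF m_all])

lemma G_less: "x \<in> G \<Longrightarrow> x k < m k"
  by (auto simp: vil_group_def PiE_iff)

text \<open>For \<open>k < N\<close> the number \<open>M N\<close> is a multiple of
  \<open>M k * m k\<close>, so adding \<open>j * M N\<close> changes the quotient by
  \<open>M k\<close> only by a multiple of \<open>m k\<close>.\<close>

lemma pt_add:
  assumes "i < M N"
  shows "k < N \<Longrightarrow> pt (j * M N + i) k = pt i k" "j < m N \<Longrightarrow> pt (j * M N + i) N = j"
proof -
  assume k: "k < N"
  have "\<exists>q. M N = M k * m k * q"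
  proof -
    have "M (Suc k) dvd M N"
      unfolding vil_M_def by (rule prod_dvd_prod_subset) (use k in auto)
    then show ?thesis by (auto simp: vil_M_simps dvd_def mult.commute mult.left_commute)
  qed
  then obtain q where q: "M N = M k * m k * q" by blast
  have "(j * M N + i) div M k = (i + m k * (q * j) * M k) div M k"
    by (simp add: q mult_ac add.commute)
  also have "\<dots> = i div M k + m k * (q * j)"
    using div_mult_self1[of "M k" i] M_pos[of k] by (simp only: add.commute not_gr_zero[symmetric] simp_thms)
  finally have "(j * M N + i) div M k = i div M k + m k * (q * j)" .
  then show "pt (j * M N + i) k = pt i k"
    by (simp add: vil_digit_def)
next
  assume "j < m N"
  then show "pt (j * M N + i) N = j"
    using assms by (simp add: vil_digit_def)
qed

lemma pt_eq_0: "i < M N \<Longrightarrow> N \<le> k \<Longrightarrow> pt i k = 0"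
  using M_mono[of N k] by (simp add: vil_digit_def)

lemma pt_inj:
  assumes "i < M N" "j < M N" "\<And>k. k < N \<Longrightarrow> pt i k = pt j k"
  shows "i = j"
proof -
  have "i = (\<Sum>k<N. pt i k * M k)" "j = (\<Sum>k<N. pt j k * M k)"
    using assms(1,2) by (simp_all add: vil_digit_partial)
  then show ?thesis using assms(3) by simp
qed

lemma pt_surj:
  assumes "x \<in> G"
  obtains u where "u < M N" "\<And>k. k < N \<Longrightarrow> pt u k = x k"
proof
  let ?u = "\<Sum>k<N. x k * M k"
  show "?u < M N" using assms by (intro vil_sum_less) (auto simp: G_less)
  show "pt ?u k = x k" if "k < N" for k
    using that
  proof (induction N)
    case (Suc N)
    have lt: "(\<Sum>k<N. x k * M k) < M N"
      using assms by (intro vil_sum_less) (auto simp: G_less)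
    have eq: "(\<Sum>k<Suc N. x k * M k) = x N * M N + (\<Sum>k<N. x k * M k)" by simp
    show ?case
    proof (cases "k = N")
      case True
      with pt_add(2)[OF lt G_less[OF assms]] show ?thesis unfolding eq by simp
    next
      case False
      with Suc.prems have "k < N" by simp
      with pt_add(1)[OF lt] Suc.IH show ?thesis unfolding eq by simp
    qed
  qed simp
qed

section \<open>The Vilenkin characters and the Dirichlet kernels of order \<open>M N\<close>\<close>

lemma psi_prod:
  assumes "i < M N"
  shows "\<psi> i x = (\<Prod>k<N. rademacher m k x ^ pt i k)"
  unfolding vil_psi_def
  by (rule prodinf_finite) (use pt_eq_0[OF assms] in auto)

text \<open>The digits of \<open>i\<close> stay in place and \<open>j\<close> becomes the leading
  digit. This factorisation drives the recursions for the Dirichlet and Fejer kernels.\<close>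

lemma psi_split:
  assumes "i < M N" "j < m N"
  shows "\<psi> (j * M N + i) x = rademacher m N x ^ j * \<psi> i x"
proof -
  have "j * M N + i < Suc j * M N" using assms by simp
  also have "\<dots> \<le> M (Suc N)"
    unfolding vil_M_simps using assms by (intro mult_right_mono) auto
  finally have "j * M N + i < M (Suc N)" .
  from psi_prod[OF this] psi_prod[OF assms(1)] pt_add[OF assms(1)] assms(2)
  show ?thesis by (simp add: mult.commute)
qed

lemma cmod_rademacher: "cmod (rademacher m k x) = 1"
proof -
  have "rademacher m k x = cis (2 * pi * real (x k) / real (m k))"
    by (simp add: rademacher_def cis_conv_exp mult_ac)
  then show ?thesis by simp
qed

lemma cmod_psi: "cmod (\<psi> i x) = 1"
  by (simp add: vil_psi_finite[OF m_all] prod_norm[symmetric] norm_power cmod_rademacher)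

lemma psi_0: "\<psi> 0 x = 1"
  by (simp add: vil_psi_finite[OF m_all])

text \<open>Evaluated at the coset representatives, the Vilenkin system is the symmetric matrix
  \<open>exp (2 \<pi> i (\<Sum>k. i\<^sub>k u\<^sub>k / m\<^sub>k))\<close>; completeness thereby yields orthonormality.\<close>

lemma psi_pt_commute:
  assumes "i < M N" "u < M N"
  shows "\<psi> i (pt u) = \<psi> u (pt i)"
  unfolding psi_prod[OF assms(1)] psi_prod[OF assms(2)]
  by (rule prod.cong[OF refl])
     (simp add: rademacher_def exp_of_nat_mult[symmetric] mult_ac)

text \<open>The ratio is an \<open>m N\<close>-th root of unity, and it is 1 only when the two
  digits agree, since they differ by less than \<open>m N\<close>; otherwise the full period of the
  geometric sum cancels.\<close>

lemma sum_powers_rademacher: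
  assumes "x \<in> G" "t \<in> G"
  shows "(\<Sum>j<m N. (rademacher m N x * cnj (rademacher m N t)) ^ j)
    = (if x N = t N then of_nat (m N) else 0)"
proof -
  let ?r = "rademacher m N x * cnj (rademacher m N t)"
  have r: "?r = cis (2 * pi * (real (x N) - real (t N)) / real (m N))"
  proof -
    have "rademacher m N y = cis (2 * pi * real (y N) / real (m N))" for y
      by (simp add: rademacher_def cis_conv_exp mult_ac)
    then show ?thesis by (simp add: cis_cnj cis_mult diff_divide_distrib algebra_simps)
  qed
  show ?thesis
  proof (cases "x N = t N")
    case True
    then show ?thesis by (simp add: r)
  next
    case False
    have "?r ^ m N = cis (real (m N) * (2 * pi * (real (x N) - real (t N)) / real (m N)))"
      unfolding r by (rule Complex.DeMoivre)
    also have "real (m N) * (2 * pi * (real (x N) - real (t N)) / real (m N))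
        = 2 * pi * of_int (int (x N) - int (t N))"
      using m_pos[of N] by simp
    finally have "?r ^ m N = cis (2 * pi * of_int (int (x N) - int (t N)))" .
    then have pow: "?r ^ m N = 1" by (simp add: cis_multiple_2pi)
    have "?r \<noteq> 1"
    proof
      assume "?r = 1"
      then have "cos (2 * pi * (real (x N) - real (t N)) / real (m N)) = 1"
        unfolding r by (metis cis.sel(1) one_complex.sel(1))
      then obtain n :: int where "2 * pi * (real (x N) - real (t N)) / real (m N) = of_int n * 2 * pi"
        unfolding cos_one_2pi_int by blast
      then have "(2 * pi) * (real (x N) - real (t N)) = (2 * pi) * (of_int n * real (m N))"
        using m_pos[of N] by (simp add: divide_eq_eq mult_ac)
      then have "real (x N) - real (t N) = of_int n * real (m N)"
        using pi_gt_zero by (simp only: mult_cancel_left) simp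
      then have eq: "int (x N) - int (t N) = n * int (m N)"
        by (metis of_int_diff of_int_eq_iff of_int_mult of_int_of_nat_eq)
      have "\<bar>int (x N) - int (t N)\<bar> < int (m N)"
        using G_less[OF assms(1), of N] G_less[OF assms(2), of N] by linarith
      then have "\<bar>n\<bar> < 1"
        unfolding eq using m_pos[of N] by (simp add: abs_mult)
      with eq False show False by simp
    qed
    with False show ?thesis by (simp add: geometric_sum pow)
  qed
qed

text \<open>Grouping the indices by their leading digit factors the sum into the one of the previous
  order and a geometric sum, which tests the agreement of one more digit.\<close>

lemma dirichlet_kernel:
  assumes "x \<in> G" "t \<in> G"
  shows "(\<Sum>i<M N. \<psi> i x * cnj (\<psi> i t)) = (if \<forall>k<N. x k = t k then of_nat (M N) else 0)"
proof (induction N)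
  case 0
  show ?case by (simp add: vil_M_simps psi_0)
next
  case (Suc N)
  let ?r = "rademacher m N x * cnj (rademacher m N t)"
  have "(\<Sum>i<M (Suc N). \<psi> i x * cnj (\<psi> i t))
      = (\<Sum>j<m N. \<Sum>i<M N. ?r ^ j * (\<psi> i x * cnj (\<psi> i t)))"
    unfolding vil_M_simps sum_lessThan_mult
    by (intro sum.cong refl) (simp add: psi_split power_mult_distrib mult_ac)
  also have "\<dots> = (\<Sum>j<m N. ?r ^ j) * (\<Sum>i<M N. \<psi> i x * cnj (\<psi> i t))"
    by (simp add: sum_product)
  also have "\<dots> = (if \<forall>k<Suc N. x k = t k then of_nat (M (Suc N)) else 0)"
    unfolding Suc sum_powers_rademacher[OF assms] by (auto simp: vil_M_simps less_Suc_eq)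
  finally show ?case .
qed

text \<open>Functions constant on the cosets \<open>I\<^sub>N(x)\<close>, that is, \<open>F\<^sub>N\<close>-measurable ones.\<close>

definition level :: "nat \<Rightarrow> ((nat \<Rightarrow> nat) \<Rightarrow> 'b) \<Rightarrow> bool" where
  "level N g \<longleftrightarrow> (\<forall>x\<in>G. \<forall>y\<in>G. (\<forall>k<N. x k = y k) \<longrightarrow> g x = g y)"

lemma levelI: "(\<And>x y. x \<in> G \<Longrightarrow> y \<in> G \<Longrightarrow> (\<And>k. k < N \<Longrightarrow> x k = y k) \<Longrightarrow> g x = g y) \<Longrightarrow> level N g"
  unfolding level_def by blast

lemma levelD: "level N g \<Longrightarrow> x \<in> G \<Longrightarrow> y \<in> G \<Longrightarrow> (\<And>k. k < N \<Longrightarrow> x k = y k) \<Longrightarrow> g x = g y"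
  unfolding level_def by blast

lemma level_compose: "level N g \<Longrightarrow> level N (\<lambda>x. F (g x))"
  unfolding level_def by metis

lemma level_compose2: "level N g \<Longrightarrow> level N h \<Longrightarrow> level N (\<lambda>x. F (g x) (h x))"
  unfolding level_def by metis

lemma level_sum: "(\<And>i. i \<in> A \<Longrightarrow> level N (g i)) \<Longrightarrow> level N (\<lambda>x. \<Sum>i\<in>A. g i x)"
  unfolding level_def by (intro ballI impI sum.cong refl) blast

lemma level_psi: "i < M N \<Longrightarrow> level N (\<psi> i)"
  by (rule levelI) (auto simp: psi_prod rademacher_def intro!: prod.cong)

lemma level_sum_psi: "n \<le> M N \<Longrightarrow> level N (\<lambda>x. \<Sum>i<n. c i * \<psi> i x)"
  by (intro level_sum level_compose2[OF level_psi, of _ _ _ "\<lambda>a b. c _ * a"] level_compose[OF level_psi]) auto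

lemma level_eq_pt:
  assumes "level N g" "x \<in> G"
  obtains u where "u < M N" "g x = g (pt u)" "x \<in> vil_interval m N (pt u)"
proof -
  obtain u where u: "u < M N" "\<And>k. k < N \<Longrightarrow> pt u k = x k" using pt_surj[OF assms(2)] by blast
  moreover have "g x = g (pt u)" using u assms by (intro levelD[OF assms(1)]) (auto simp: pt_in_G)
  moreover have "x \<in> vil_interval m N (pt u)" using u assms by (auto simp: vil_interval_def)
  ultimately show thesis using that by blast
qed

lemma interval_eq: "level N g \<Longrightarrow> x \<in> vil_interval m N (pt u) \<Longrightarrow> g x = g (pt u)"
  by (rule levelD[of N g]) (auto simp: vil_interval_def pt_in_G)

lemma disjoint_intervals:
  assumes "u < M N" "v < M N" "x \<in> vil_interval m N (pt u)" "x \<in> vil_interval m N (pt v)"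
  shows "u = v"
proof (rule pt_inj[OF assms(1,2)])
  fix k assume "k < N"
  then have "x k = pt u k" "x k = pt v k"
    using assms(3,4) unfolding vil_interval_def by blast+
  then show "pt u k = pt v k" by simp
qed

text \<open>Preimages are finite unions of cosets, which settles measurability for the filtration
  and for the Haar measure at once.\<close>

lemma vimage_level:
  assumes "level N g"
  shows "g -` A \<inter> G = (\<Union>u\<in>{u. u < M N \<and> g (pt u) \<in> A}. vil_interval m N (pt u))"
proof (intro equalityI subsetI)
  fix x assume "x \<in> g -` A \<inter> G"
  then have x: "x \<in> G" "g x \<in> A" by simp_all
  from level_eq_pt[OF assms x(1)] obtain u
    where "u < M N" "g x = g (pt u)" "x \<in> vil_interval m N (pt u)" .
  with x show "x \<in> (\<Union>u\<in>{u. u < M N \<and> g (pt u) \<in> A}. vil_interval m N (pt u))" by force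
next
  fix x assume "x \<in> (\<Union>u\<in>{u. u < M N \<and> g (pt u) \<in> A}. vil_interval m N (pt u))"
  then obtain u where u: "g (pt u) \<in> A" "x \<in> vil_interval m N (pt u)" by blast
  then have "x \<in> G" by (simp add: vil_interval_def)
  with u interval_eq[OF assms u(2)] show "x \<in> g -` A \<inter> G" by simp
qed

lemma level_measurable_filtration:
  assumes "level N g"
  shows "g \<in> borel_measurable (vil_filtration m N)"
proof (rule measurableI)
  have S: "vil_interval m N ` G \<subseteq> Pow G" by (auto simp: vil_interval_def)
  fix A :: "'a set"
  show "g -` A \<inter> space (vil_filtration m N) \<in> sets (vil_filtration m N)"
    unfolding vil_filtration_def space_measure_of[OF S] sets_measure_of[OF S] vimage_level[OF assms]
    by (rule sigma_sets_UNION) (auto intro!: countable_finite sigma_sets.Basic imageI pt_in_G)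
qed simp

lemma level_measurable:
  assumes "level N g"
  shows "g \<in> measurable \<mu> (count_space UNIV)"
proof (rule measurableI)
  fix A
  show "g -` A \<inter> space \<mu> \<in> sets \<mu>"
    unfolding space_vil_haar vimage_level[OF assms]
    by (intro sets.finite_UN) (auto simp: vil_interval_in_sets)
qed simp

lemma level_borel_measurable: "level N g \<Longrightarrow> g \<in> borel_measurable \<mu>"
  using measurable_compose[of g \<mu> "count_space UNIV" "\<lambda>x. x" borel] level_measurable[of N g] by simp

section \<open>Integrals as averages over coset representatives\<close>

lemma finite_measure_haar: "finite_measure \<mu>"
  using prob_space_vil_haar[OF m_all] by (rule prob_space.finite_measure)

lemma emeasure_interval:
  assumes "x \<in> G"
  shows "emeasure \<mu> (vil_interval m N x) = ennreal (1 / real (M N))"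
proof -
  let ?U = "\<lambda>k. uniform_count_measure {..<m k}"
  have ps: "prob_space (?U k)" for k
    using m_pos by (intro prob_space_uniform_count_measure) auto
  interpret Q: product_prob_space ?U UNIV
    using ps by (auto simp: product_prob_space_def product_prob_space_axioms_def
        product_sigma_finite_def prob_space_imp_sigma_finite)
  have "vil_interval m N x = prod_emb UNIV ?U {..<N} (\<Pi>\<^sub>E i\<in>{..<N}. {x i})"
    using G_less[OF assms]
    by (auto simp: vil_interval_def prod_emb_def vil_group_def PiE_iff space_uniform_count_measure
        restrict_def extensional_def)
  then have "emeasure \<mu> (vil_interval m N x) = (\<Prod>i<N. emeasure (?U i) {x i})"
    unfolding vil_haar_def
    by (simp, intro Q.emeasure_PiM_emb) (use G_less[OF assms] in \<open>auto simp: sets_uniform_count_measure\<close>)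
  also have "\<dots> = (\<Prod>i<N. ennreal (1 / real (m i)))"
    using G_less[OF assms] by (intro prod.cong refl) (subst emeasure_uniform_count_measure, auto)
  also have "\<dots> = ennreal (1 / real (M N))"
    by (subst prod_ennreal) (auto simp: vil_M_def prod_dividef)
  finally show ?thesis .
qed

lemma measure_interval: "x \<in> G \<Longrightarrow> measure \<mu> (vil_interval m N x) = 1 / real (M N)"
  by (simp add: measure_def emeasure_interval)

lemma level_indicator_sum:
  fixes g :: "(nat \<Rightarrow> nat) \<Rightarrow> 'b::{banach, second_countable_topology}"
  assumes "level N g" "x \<in> G"
  shows "g x = (\<Sum>u<M N. indicator (vil_interval m N (pt u)) x *\<^sub>R g (pt u))"
proof -
  from level_eq_pt[OF assms] obtain v
    where v: "v < M N" "g x = g (pt v)" "x \<in> vil_interval m N (pt v)" .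
  have "(\<Sum>u<M N. indicator (vil_interval m N (pt u)) x *\<^sub>R g (pt u)) = (\<Sum>u<M N. if u = v then g (pt v) else 0)"
  proof (rule sum.cong[OF refl])
    fix u assume u: "u \<in> {..<M N}"
    have "x \<in> vil_interval m N (pt u) \<longleftrightarrow> u = v"
      using disjoint_intervals[OF _ v(1) _ v(3), of u] u v(3) by blast
    then show "indicator (vil_interval m N (pt u)) x *\<^sub>R g (pt u) = (if u = v then g (pt v) else 0)"
      using v(3) by simp
  qed
  with v show ?thesis by simp
qed

text \<open>Such a function is a finite combination of indicators of cosets, each of measure
  \<open>1 / M N\<close>. The later integrability claims rest on this.\<close>

lemma has_integral_level:
  fixes g :: "(nat \<Rightarrow> nat) \<Rightarrow> 'b::{banach, second_countable_topology}"
  assumes "level N g"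
  shows "has_bochner_integral \<mu> g ((1 / real (M N)) *\<^sub>R (\<Sum>u<M N. g (pt u)))"
proof -
  have "has_bochner_integral \<mu> (\<lambda>x. \<Sum>u<M N. indicator (vil_interval m N (pt u)) x *\<^sub>R g (pt u))
     (\<Sum>u<M N. measure \<mu> (vil_interval m N (pt u)) *\<^sub>R g (pt u))"
    by (intro has_bochner_integral_sum has_bochner_integral_scaleR_left has_bochner_integral_real_indicator)
       (auto simp: vil_interval_in_sets finite_measure.emeasure_finite[OF finite_measure_haar] less_top[symmetric])
  also have "(\<Sum>u<M N. measure \<mu> (vil_interval m N (pt u)) *\<^sub>R g (pt u)) = (1 / real (M N)) *\<^sub>R (\<Sum>u<M N. g (pt u))"
    by (simp add: measure_interval pt_in_G scaleR_sum_right)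
  finally show ?thesis
    by (rule has_bochner_integral_cong[THEN iffD2, OF refl _ refl, rotated])
       (rule level_indicator_sum[OF assms], simp add: space_vil_haar)
qed

lemma
  fixes g :: "(nat \<Rightarrow> nat) \<Rightarrow> 'b::{banach, second_countable_topology}"
  assumes "level N g"
  shows integrable_level: "integrable \<mu> g"
    and integral_level: "integral\<^sup>L \<mu> g = (1 / real (M N)) *\<^sub>R (\<Sum>u<M N. g (pt u))"
  using has_integral_level[OF assms] by (auto simp: has_bochner_integral_iff)

lemma psi_orthonormal: "(LINT x|\<mu>. \<psi> i x * cnj (\<psi> j x)) = (if i = j then 1 else 0)"
proof -
  define N where "N = i + j"
  have ij: "i < M N" "j < M N"
    using vil_M_gt[OF m_all, of N] by (auto simp: N_def)
  have "(LINT x|\<mu>. \<psi> i x * cnj (\<psi> j x)) = (1 / real (M N)) *\<^sub>R (\<Sum>u<M N. \<psi> i (pt u) * cnj (\<psi> j (pt u)))"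
    by (intro integral_level level_compose2[OF level_psi level_psi] ij)
  also have "(\<Sum>u<M N. \<psi> i (pt u) * cnj (\<psi> j (pt u))) = (\<Sum>u<M N. \<psi> u (pt i) * cnj (\<psi> u (pt j)))"
    by (intro sum.cong refl) (simp add: psi_pt_commute[of _ N] ij)
  also have "\<dots> = (if i = j then of_nat (M N) else 0)"
    unfolding dirichlet_kernel[OF pt_in_G pt_in_G] using pt_inj[OF ij] by auto
  finally show ?thesis using M_pos[of N] by (auto simp: scaleR_conv_of_real)
qed

subsection \<open>Martingales and their Fourier coefficients\<close>

text \<open>The martingale with prescribed coefficients. By \<open>martingale_eq_trig\<close> every
  martingale has this form on the group, so the later arguments work with coefficient
  sequences.\<close>

definition trig :: "(nat \<Rightarrow> complex) \<Rightarrow> mart" where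
  "trig c n x = (\<Sum>i<M n. c i * \<psi> i x)"

lemma level_trig: "level n (trig c n)"
  unfolding trig_def[abs_def] by (rule level_sum_psi) simp

lemma fourier_coeff_cong:
  "(\<And>x. x \<in> G \<Longrightarrow> g x = h x) \<Longrightarrow> fourier_coeff m g j = fourier_coeff m h j"
  unfolding fourier_coeff_def by (intro Bochner_Integration.integral_cong) (auto simp: space_vil_haar)

lemma fourier_coeff_sum_psi:
  "fourier_coeff m (\<lambda>x. \<Sum>i<n. c i * \<psi> i x) j = (if j < n then c j else 0)"
proof -
  define N where "N = n + j"
  have N: "n \<le> M N" "j < M N"
    using vil_M_gt[OF m_all, of N] by (auto simp: N_def)
  have int: "integrable \<mu> (\<lambda>x. \<psi> i x * cnj (\<psi> j x))" if "i < n" for i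
    by (rule integrable_level[of N], rule level_compose2[of N "\<psi> i" "\<psi> j" "\<lambda>a b. a * cnj b"])
       (use N that in \<open>auto intro!: level_psi\<close>)
  have "fourier_coeff m (\<lambda>x. \<Sum>i<n. c i * \<psi> i x) j = (LINT x|\<mu>. (\<Sum>i<n. c i * (\<psi> i x * cnj (\<psi> j x))))"
    unfolding fourier_coeff_def by (simp add: sum_distrib_left sum_distrib_right mult_ac)
  also have "\<dots> = (\<Sum>i<n. c i * (LINT x|\<mu>. \<psi> i x * cnj (\<psi> j x)))"
    using int by (subst Bochner_Integration.integral_sum) auto
  also have "\<dots> = (if j < n then c j else 0)"
    by (simp add: psi_orthonormal if_distrib[of "(*) _"] cong: if_cong)
  finally show ?thesis .
qed

lemma fourier_coeff_trig: "i < M n \<Longrightarrow> fourier_coeff m (trig c n) i = c i"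
  unfolding trig_def[abs_def] fourier_coeff_sum_psi by simp

lemma martingale_trig: "is_martingale m (trig c)"
  unfolding is_martingale_def
proof (intro conjI allI impI ballI)
  fix n k x assume "n \<le> (k::nat)"
  then show "partial_sum m (M n) (trig c k) x = trig c n x"
    unfolding partial_sum_def trig_def[of c n]
    using M_mono[of n k] by (intro sum.cong refl) (simp add: fourier_coeff_trig)
qed (auto intro: integrable_level[OF level_trig] level_measurable_filtration[OF level_trig])

text \<open>Coefficient \<open>i\<close> of level \<open>k\<close> no longer changes once
  \<open>i \<le> k\<close>, because then \<open>i < M k\<close>; the defining limit is that of an
  eventually constant sequence.\<close>

lemma mart_coeff_eqI:
  assumes "\<And>k x. x \<in> G \<Longrightarrow> f k x = trig c k x"
  shows "mart_coeff m f = c"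
proof
  fix i
  have "fourier_coeff m (f k) i = c i" if "i \<le> k" for k
    using fourier_coeff_cong[of "f k" "trig c k" i] assms fourier_coeff_trig[of i k c]
      vil_M_gt[OF m_all, of k] that by simp
  then have "(\<lambda>k. fourier_coeff m (f k) i) \<longlonglongrightarrow> c i"
    by (intro tendsto_eventually eventually_sequentiallyI[of i]) auto
  then show "mart_coeff m f i = c i" unfolding mart_coeff_def by (rule limI)
qed

text \<open>Compatibility of the levels makes the coefficients below \<open>M n\<close> the same at
  every level from \<open>n\<close> on, so they equal the limit coefficients.\<close>

lemma martingale_eq_trig:
  assumes "is_martingale m f" "x \<in> G"
  shows "f n x = trig (mart_coeff m f) n x"
proof -
  have S: "partial_sum m (M n) (f k) y = f n y" if "n \<le> k" "y \<in> G" for n k y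
    using assms(1) that unfolding is_martingale_def by blast
  have eq: "fourier_coeff m (f n) i = fourier_coeff m (f k) i" if "i < M n" "n \<le> k" for i k
  proof -
    have "fourier_coeff m (f n) i = fourier_coeff m (partial_sum m (M n) (f k)) i"
      by (rule fourier_coeff_cong) (simp add: S that)
    also have "\<dots> = fourier_coeff m (f k) i"
      unfolding partial_sum_def[abs_def] fourier_coeff_sum_psi using that by simp
    finally show ?thesis .
  qed
  have "mart_coeff m f i = fourier_coeff m (f n) i" if "i < M n" for i
    unfolding mart_coeff_def
    by (intro limI tendsto_eventually eventually_sequentiallyI[of n]) (simp add: eq that)
  then show ?thesis
    using S[of n n x] assms(2) by (simp add: trig_def partial_sum_def)
qed

lemma mart_of_fun_sum_psi:
  "mart_of_fun m (\<lambda>x. \<Sum>i<n. d i * \<psi> i x) k x = trig (\<lambda>i. if i < n then d i else 0) k x"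
  unfolding mart_of_fun_def partial_sum_def fourier_coeff_sum_psi trig_def ..

text \<open>The coefficients of \<open>f - S_{M_n} f\<close>, hence those that enter the modulus of
  continuity.\<close>

definition tail :: "nat \<Rightarrow> (nat \<Rightarrow> complex) \<Rightarrow> nat \<Rightarrow> complex" where
  "tail n c i = (if i < M n then 0 else c i)"

lemma Hp_norm_cong:
  assumes "\<And>k x. x \<in> G \<Longrightarrow> f k x = g k x"
  shows "Hp_norm m p f = Hp_norm m p g"
proof -
  have "(\<integral>\<^sup>+x. ennreal_powr (maximal_fun f x) p \<partial>\<mu>) = (\<integral>\<^sup>+x. ennreal_powr (maximal_fun g x) p \<partial>\<mu>)"
    by (intro nn_integral_cong) (simp add: assms maximal_fun_def space_vil_haar)
  then show ?thesis by (simp add: Hp_norm_def Lp_norm_def)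
qed

lemma weak_Lp_norm_cong:
  assumes "\<And>x. x \<in> G \<Longrightarrow> f x = g x"
  shows "weak_Lp_norm m p f = weak_Lp_norm m p g"
proof -
  have "{x \<in> space \<mu>. l < cmod (f x)} = {x \<in> space \<mu>. l < cmod (g x)}" for l
    using assms by (auto simp: space_vil_haar)
  then show ?thesis by (simp add: weak_Lp_norm_def)
qed

lemma Hp_modulus_eq:
  assumes "\<And>k x. x \<in> G \<Longrightarrow> f k x = trig c k x"
  shows "Hp_modulus m p n f = Hp_norm m p (trig (tail n c))"
  unfolding Hp_modulus_def
proof (rule Hp_norm_cong)
  fix k x assume x: "x \<in> G"
  have "mart_partial_sum m (M n) f = (\<lambda>x. \<Sum>i<M n. c i * \<psi> i x)"
    by (simp add: fun_eq_iff mart_partial_sum_def mart_coeff_eqI[of f c, OF assms])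
  then show "mart_diff f (mart_of_fun m (mart_partial_sum m (M n) f)) k x = trig (tail n c) k x"
    using x by (simp add: mart_diff_def mart_of_fun_sum_psi assms)
      (simp add: trig_def tail_def sum_subtractf[symmetric] if_distrib if_distribR cong: if_cong)
qed

text \<open>The index \<open>i\<close> occurs in the partial sums of orders \<open>i + 1\<close> to
  \<open>n\<close>, that is, \<open>n - i\<close> times.\<close>

lemma mart_fejer_eq:
  assumes "\<And>k x. x \<in> G \<Longrightarrow> f k x = trig c k x"
  shows "mart_fejer m n f = (\<lambda>x. \<Sum>i<n. (of_nat (n - i) / of_nat n * c i) * \<psi> i x)"
proof
  fix x
  have "(\<Sum>k=1..n. \<Sum>i<k. a i) = (\<Sum>i<n. of_nat (n - i) * a i)" for a :: "nat \<Rightarrow> complex"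
  proof (induction n)
    case (Suc n)
    have "(\<Sum>k=1..Suc n. \<Sum>i<k. a i) = (\<Sum>i<n. of_nat (n - i) * a i + a i) + a n"
      using Suc by (simp add: sum.distrib)
    also have "(\<Sum>i<n. of_nat (n - i) * a i + a i) = (\<Sum>i<n. of_nat (Suc n - i) * a i)"
    proof (rule sum.cong[OF refl])
      fix i assume "i \<in> {..<n}"
      then have "Suc n - i = Suc (n - i)" by (simp add: Suc_diff_le)
      then show "of_nat (n - i) * a i + a i = of_nat (Suc n - i) * a i"
        by (simp only: of_nat_Suc) (simp add: algebra_simps)
    qed
    finally show ?case by simp
  qed simp
  then show "mart_fejer m n f x = (\<Sum>i<n. (of_nat (n - i) / of_nat n * c i) * \<psi> i x)"
    by (simp add: mart_fejer_def mart_partial_sum_def mart_coeff_eqI[of f c, OF assms] sum_divide_distrib mult.assoc)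
qed

definition fejer_err_coeff :: "nat \<Rightarrow> (nat \<Rightarrow> complex) \<Rightarrow> nat \<Rightarrow> complex" where
  "fejer_err_coeff n c i = - (of_nat (min i n) / of_nat n * c i)"

lemma fejer_error_eq:
  assumes "\<And>k x. x \<in> G \<Longrightarrow> f k x = trig c k x" and "0 < n" and "x \<in> G"
  shows "fejer_error m n f k x = trig (fejer_err_coeff n c) k x"
proof -
  \<comment> \<open>Below \<open>n\<close> the factor is \<open>(n - i) / n - 1 = - i / n\<close>,
    and from \<open>n\<close> on it is \<open>- 1\<close>; the minimum covers both.\<close>
  have "(if i < n then of_nat (n - i) / of_nat n * c i else 0) - c i = fejer_err_coeff n c i" for i
    using assms(2) by (auto simp: fejer_err_coeff_def of_nat_diff field_simps min_def)
  note E = this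
  have "mart_fejer m n f = (\<lambda>x. \<Sum>i<n. (of_nat (n - i) / of_nat n * c i) * \<psi> i x)"
    by (rule mart_fejer_eq) (rule assms(1))
  note F = this
  show ?thesis
    unfolding fejer_error_def mart_diff_def F mart_of_fun_sum_psi assms(1)[OF assms(3)]
    unfolding trig_def sum_subtractf[symmetric] left_diff_distrib[symmetric] E ..
qed

section \<open>Powers of the quasi-norms and the decomposition into blocks\<close>

definition Lp_pow :: "real \<Rightarrow> ((nat \<Rightarrow> nat) \<Rightarrow> complex) \<Rightarrow> real" where
  "Lp_pow p g = (LINT x|\<mu>. cmod (g x) powr p)"

text \<open>Working with \<open>p\<close>-th powers replaces the triangle inequality, which fails
  for \<open>p < 1\<close>, by subadditivity.\<close>

definition Hp_pow :: "real \<Rightarrow> mart \<Rightarrow> ennreal" where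
  "Hp_pow p f = (\<integral>\<^sup>+x. ennreal_powr (maximal_fun f x) p \<partial>\<mu>)"

lemma Hp_norm_eq: "Hp_norm m p f = ennreal_powr (Hp_pow p f) (1 / p)"
  by (simp add: Hp_norm_def Lp_norm_def Hp_pow_def)

lemma Lp_pow_nonneg: "0 \<le> Lp_pow p g"
  by (simp add: Lp_pow_def)

lemma Lp_pow_level: "level N g \<Longrightarrow> Lp_pow p g = (\<Sum>u<M N. cmod (g (pt u)) powr p) / real (M N)"
  unfolding Lp_pow_def by (subst integral_level[OF level_compose]) auto

lemma nn_integral_Lp_pow:
  assumes "level N g"
  shows "(\<integral>\<^sup>+x. ennreal (cmod (g x) powr p) \<partial>\<mu>) = ennreal (Lp_pow p g)"
  unfolding Lp_pow_def
  by (rule nn_integral_eq_integral) (auto intro: integrable_level[OF level_compose[OF assms]])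

lemma measurable_maximal_trig: "(\<lambda>x. maximal_fun (trig c) x) \<in> borel_measurable \<mu>"
  unfolding maximal_fun_def using level_borel_measurable[OF level_trig] by measurable

text \<open>The martingale difference between the levels \<open>k\<close> and
  \<open>k + 1\<close>.\<close>

definition blk :: "(nat \<Rightarrow> complex) \<Rightarrow> nat \<Rightarrow> (nat \<Rightarrow> nat) \<Rightarrow> complex" where
  "blk c k x = (\<Sum>i\<in>{M k..<M (Suc k)}. c i * \<psi> i x)"

lemma level_blk: "level (Suc k) (blk c k)"
  unfolding blk_def[abs_def]
  by (intro level_sum level_compose2[OF level_psi, of _ _ _ "\<lambda>a b. c _ * a"] level_compose[OF level_psi]) auto

text \<open>The first block begins at index \<open>M 0 = 1\<close>, so the coefficient at 0 belongs
  to no block and has to vanish.\<close>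

lemma trig_eq_sum_blk:
  assumes "c 0 = 0"
  shows "trig c n x = (\<Sum>k<n. blk c k x)"
proof (induction n)
  case 0
  show ?case using assms by (simp add: trig_def vil_M_simps)
next
  case (Suc n)
  have "trig c (Suc n) x = trig c n x + blk c n x"
    unfolding trig_def blk_def lessThan_atLeast0
    using M_mono[of n "Suc n"] by (simp add: sum.atLeastLessThan_concat)
  with Suc show ?case by simp
qed

lemma blk_tail: "blk (tail n c) k x = (if k < n then 0 else blk c k x)"
proof -
  have "blk (tail n c) k x = (\<Sum>i\<in>{M k..<M (Suc k)}. if k < n then 0 else c i * \<psi> i x)"
    unfolding blk_def
  proof (intro sum.cong refl)
    fix i assume i: "i \<in> {M k..<M (Suc k)}"
    show "tail n c i * \<psi> i x = (if k < n then 0 else c i * \<psi> i x)"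
    proof (cases "k < n")
      case True
      with i M_mono[of "Suc k" n] show ?thesis by (simp add: tail_def)
    next
      case False
      with i M_mono[of n k] show ?thesis by (simp add: tail_def)
    qed
  qed
  then show ?thesis by (simp add: blk_def)
qed

lemma tail_0: "tail n c 0 = 0"
  using M_pos[of n] by (simp add: tail_def)

lemma blk_eq_trig: "blk c k x = trig (tail k c) (Suc k) x"
proof -
  have "trig (tail k c) (Suc k) x = (\<Sum>j<Suc k. if j < k then 0 else blk c j x)"
    by (simp only: trig_eq_sum_blk[of "tail _ c", OF tail_0] blk_tail)
  then show ?thesis by simp
qed

lemma cmod_trig_powr_le:
  assumes "c 0 = 0" "0 < p" "p \<le> 1"
  shows "cmod (trig c n x) powr p \<le> (\<Sum>k<n. cmod (blk c k x) powr p)"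
proof -
  have "cmod (trig c n x) powr p \<le> (\<Sum>k<n. cmod (blk c k x)) powr p"
    unfolding trig_eq_sum_blk[of c, OF assms(1)] using assms by (intro powr_mono2 norm_sum) auto
  also have "\<dots> \<le> (\<Sum>k<n. cmod (blk c k x) powr p)"
    using assms by (intro powr_sum_le) auto
  finally show ?thesis .
qed

text \<open>The series of the \<open>p\<close>-th powers of the blocks dominates all levels
  simultaneously, hence also the maximal function.\<close>

lemma Hp_pow_le_suminf:
  assumes "c 0 = 0" "0 < p" "p \<le> 1"
  shows "Hp_pow p (trig c) \<le> (\<Sum>k. ennreal (Lp_pow p (blk c k)))"
proof -
  have "ennreal_powr (maximal_fun (trig c) x) p \<le> (\<Sum>k. ennreal (cmod (blk c k x) powr p))" for x
    unfolding maximal_fun_def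
  proof (rule ennreal_powr_SUP_le[OF assms(2)])
    fix n
    have "ennreal_powr (ennreal (cmod (trig c n x))) p = ennreal (cmod (trig c n x) powr p)"
      by (simp add: ennreal_powr_ennreal)
    also have "\<dots> \<le> ennreal (\<Sum>k<n. cmod (blk c k x) powr p)"
      by (intro ennreal_leI cmod_trig_powr_le assms)
    also have "\<dots> = (\<Sum>k<n. ennreal (cmod (blk c k x) powr p))"
      by (simp add: sum_ennreal)
    also have "\<dots> \<le> (\<Sum>k. ennreal (cmod (blk c k x) powr p))"
      by (rule sum_le_suminf) auto
    finally show "ennreal_powr (ennreal (cmod (trig c n x))) p \<le> (\<Sum>k. ennreal (cmod (blk c k x) powr p))" .
  qed
  then have "Hp_pow p (trig c) \<le> (\<integral>\<^sup>+x. (\<Sum>k. ennreal (cmod (blk c k x) powr p)) \<partial>\<mu>)"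
    unfolding Hp_pow_def by (intro nn_integral_mono)
  also have "\<dots> = (\<Sum>k. \<integral>\<^sup>+x. ennreal (cmod (blk c k x) powr p) \<partial>\<mu>)"
    by (rule nn_integral_suminf) (use level_borel_measurable[OF level_blk] in measurable)
  also have "\<dots> = (\<Sum>k. ennreal (Lp_pow p (blk c k)))"
    by (simp add: nn_integral_Lp_pow[OF level_blk])
  finally show ?thesis .
qed

text \<open>Only finitely many blocks are separated. The rest is kept under one maximal function, so
  that a bound on the tail, which is what the modulus of continuity provides, applies
  directly.\<close>

lemma Hp_pow_le_blocks_tail:
  assumes "c 0 = 0" "0 < p" "p \<le> 1"
  shows "Hp_pow p (trig c) \<le> ennreal (\<Sum>k<K. Lp_pow p (blk c k)) + Hp_pow p (trig (tail K c))"
proof -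
  have "ennreal_powr (maximal_fun (trig c) x) p \<le> (\<Sum>k<K. ennreal (cmod (blk c k x) powr p))
      + ennreal_powr (maximal_fun (trig (tail K c)) x) p" for x
    unfolding maximal_fun_def[of "trig c"]
  proof (rule ennreal_powr_SUP_le[OF assms(2)])
    fix n
    have "trig c n x = (\<Sum>k<n. if k < K then blk c k x else 0) + (\<Sum>k<n. if k < K then 0 else blk c k x)"
      unfolding trig_eq_sum_blk[of c, OF assms(1)] sum.distrib[symmetric] by (intro sum.cong) auto
    also have "(\<Sum>k<n. if k < K then 0 else blk c k x) = trig (tail K c) n x"
      unfolding trig_eq_sum_blk[of "tail _ c", OF tail_0] blk_tail ..
    also have "(\<Sum>k<n. if k < K then blk c k x else 0) = (\<Sum>k\<in>{..<n} \<inter> {..<K}. blk c k x)"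
      by (simp add: sum.If_cases lessThan_def)
    finally have "cmod (trig c n x)
        \<le> cmod (\<Sum>k\<in>{..<n} \<inter> {..<K}. blk c k x) + cmod (trig (tail K c) n x)"
      by (simp only: norm_triangle_ineq)
    also have "cmod (\<Sum>k\<in>{..<n} \<inter> {..<K}. blk c k x) \<le> (\<Sum>k\<in>{..<n} \<inter> {..<K}. cmod (blk c k x))"
      by (rule norm_sum)
    also have "(\<Sum>k\<in>{..<n} \<inter> {..<K}. cmod (blk c k x)) \<le> (\<Sum>k<K. cmod (blk c k x))"
      by (intro sum_mono2) auto
    finally have "cmod (trig c n x) powr p
        \<le> ((\<Sum>k<K. cmod (blk c k x)) + cmod (trig (tail K c) n x)) powr p"
      using assms by (intro powr_mono2) auto
    also have "\<dots> \<le> (\<Sum>k<K. cmod (blk c k x)) powr p + cmod (trig (tail K c) n x) powr p"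
      using assms by (intro powr_add_le sum_nonneg) auto
    also have "\<dots> \<le> (\<Sum>k<K. cmod (blk c k x) powr p) + cmod (trig (tail K c) n x) powr p"
      using assms by (intro add_right_mono powr_sum_le) auto
    finally have *: "ennreal (cmod (trig c n x) powr p)
        \<le> ennreal ((\<Sum>k<K. cmod (blk c k x) powr p) + cmod (trig (tail K c) n x) powr p)"
      by (rule ennreal_leI)
    have "ennreal_powr (ennreal (cmod (trig (tail K c) n x))) p
        \<le> ennreal_powr (maximal_fun (trig (tail K c)) x) p"
      unfolding maximal_fun_def using assms by (intro ennreal_powr_mono SUP_upper) auto
    then have "ennreal (cmod (trig (tail K c) n x) powr p) \<le> ennreal_powr (maximal_fun (trig (tail K c)) x) p"
      by (simp add: ennreal_powr_ennreal)
    with * show "ennreal_powr (ennreal (cmod (trig c n x))) p \<le> (\<Sum>k<K. ennreal (cmod (blk c k x) powr p))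
      + ennreal_powr (maximal_fun (trig (tail K c)) x) p"
      by (simp add: ennreal_powr_ennreal ennreal_plus sum_nonneg sum_ennreal)
         (meson add_left_mono order_trans)
  qed
  then have "Hp_pow p (trig c) \<le> (\<integral>\<^sup>+x. (\<Sum>k<K. ennreal (cmod (blk c k x) powr p))
      + ennreal_powr (maximal_fun (trig (tail K c)) x) p \<partial>\<mu>)"
    unfolding Hp_pow_def[of p "trig c"] by (intro nn_integral_mono)
  also have "\<dots> = (\<integral>\<^sup>+x. (\<Sum>k<K. ennreal (cmod (blk c k x) powr p)) \<partial>\<mu>) + Hp_pow p (trig (tail K c))"
    unfolding Hp_pow_def
  proof (rule nn_integral_add)
    have "(\<lambda>x. cmod (blk c k x) powr p) \<in> borel_measurable \<mu>" for k
      by (rule level_borel_measurable) (rule level_compose[OF level_blk])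
    then show "(\<lambda>x. \<Sum>k<K. ennreal (cmod (blk c k x) powr p)) \<in> borel_measurable \<mu>"
      by measurable
    show "(\<lambda>x. ennreal_powr (maximal_fun (trig (tail K c)) x) p) \<in> borel_measurable \<mu>"
      by (intro borel_measurable_ennreal_powr measurable_maximal_trig)
  qed
  also have "(\<integral>\<^sup>+x. (\<Sum>k<K. ennreal (cmod (blk c k x) powr p)) \<partial>\<mu>) = (\<Sum>k<K. ennreal (Lp_pow p (blk c k)))"
    using level_borel_measurable[OF level_blk]
    by (subst nn_integral_sum) (auto simp: nn_integral_Lp_pow[OF level_blk])
  also have "\<dots> = ennreal (\<Sum>k<K. Lp_pow p (blk c k))"
    by (simp add: Lp_pow_nonneg sum_ennreal)
  finally show ?thesis .
qed

text \<open>The block is level \<open>k + 1\<close> of the tail martingale and thus lies below its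
  maximal function.\<close>

lemma Lp_pow_blk_le_Hp_pow:
  assumes "0 < p"
  shows "ennreal (Lp_pow p (blk c k)) \<le> Hp_pow p (trig (tail k c))"
  unfolding Hp_pow_def nn_integral_Lp_pow[OF level_blk, symmetric]
proof (rule nn_integral_mono)
  fix x
  have "ennreal (cmod (blk c k x)) \<le> maximal_fun (trig (tail k c)) x"
    unfolding maximal_fun_def blk_eq_trig by (rule SUP_upper) simp
  then have "ennreal_powr (ennreal (cmod (blk c k x))) p \<le> ennreal_powr (maximal_fun (trig (tail k c)) x) p"
    by (rule ennreal_powr_mono) (rule assms)
  then show "ennreal (cmod (blk c k x) powr p) \<le> ennreal_powr (maximal_fun (trig (tail k c)) x) p"
    by (simp add: ennreal_powr_ennreal)
qed

subsection \<open>Fejer kernels\<close>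

text \<open>\<open>fejer_ker n t x\<close> is \<open>n K\<^sub>n(x - t)\<close> in the usual notation; with two arguments
  no group subtraction is needed.\<close>

definition fejer_ker :: "nat \<Rightarrow> (nat \<Rightarrow> nat) \<Rightarrow> (nat \<Rightarrow> nat) \<Rightarrow> complex" where
  "fejer_ker n t x = (\<Sum>l<n. of_nat (n - l) * (\<psi> l x * cnj (\<psi> l t)))"

lemma level_fejer_ker:
  assumes "n \<le> M N"
  shows "level N (fejer_ker n t)"
proof -
  have "fejer_ker n t = (\<lambda>x. \<Sum>l<n. of_nat (n - l) * cnj (\<psi> l t) * \<psi> l x)"
    by (simp add: fun_eq_iff fejer_ker_def mult_ac)
  with level_sum_psi[OF assms, of "\<lambda>l. of_nat (n - l) * cnj (\<psi> l t)"] show ?thesis by simp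
qed

lemma fejer_ker_split:
  fixes x t :: "nat \<Rightarrow> nat" and j i0 N :: nat
  assumes "j \<le> m N" "i0 = 0 \<or> j < m N" "i0 < M N"
  defines "n \<equiv> j * M N + i0" and "r \<equiv> rademacher m N x * cnj (rademacher m N t)"
  shows "fejer_ker n t x = (\<Sum>i<j. r ^ i) * fejer_ker (M N) t x
     + (\<Sum>i<j. r ^ i * of_nat (n - Suc i * M N)) * (\<Sum>l<M N. \<psi> l x * cnj (\<psi> l t))
     + r ^ j * fejer_ker i0 t x"
proof -
  let ?e = "\<lambda>l. \<psi> l x * cnj (\<psi> l t)"
  have e: "?e (i * M N + l) = r ^ i * ?e l" if "l < M N" "i < m N" for i l
    using that by (simp add: psi_split r_def power_mult_distrib mult_ac)
  have "fejer_ker n t x = (\<Sum>i<j. \<Sum>l<M N. of_nat (n - (i * M N + l)) * ?e (i * M N + l))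
      + (\<Sum>l<i0. of_nat (n - (j * M N + l)) * ?e (j * M N + l))"
    unfolding fejer_ker_def
    by (subst n_def, subst sum_lessThan_add, subst sum_lessThan_mult) simp
  also have "(\<Sum>l<i0. of_nat (n - (j * M N + l)) * ?e (j * M N + l)) = r ^ j * fejer_ker i0 t x"
    unfolding fejer_ker_def sum_distrib_left
  proof (rule sum.cong[OF refl])
    fix l assume "l \<in> {..<i0}"
    with assms have "l < M N" "j < m N" by auto
    then show "of_nat (n - (j * M N + l)) * ?e (j * M N + l) = r ^ j * (of_nat (i0 - l) * ?e l)"
      by (simp only: e n_def) simp
  qed
  also have "(\<Sum>i<j. \<Sum>l<M N. of_nat (n - (i * M N + l)) * ?e (i * M N + l))
    = (\<Sum>i<j. r ^ i * (of_nat (n - Suc i * M N) * (\<Sum>l<M N. ?e l) + fejer_ker (M N) t x))"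
    unfolding fejer_ker_def sum_distrib_left sum.distrib[symmetric]
  proof (intro sum.cong refl)
    fix i l assume *: "i \<in> {..<j}" "l \<in> {..<M N}"
    then have "Suc i * M N \<le> j * M N" by (intro mult_right_mono) auto
    with * have "n - (i * M N + l) = (n - Suc i * M N) + (M N - l)"
      unfolding n_def by simp
    moreover have "?e (i * M N + l) = r ^ i * ?e l"
      using * assms by (intro e) auto
    ultimately show "of_nat (n - (i * M N + l)) * ?e (i * M N + l)
      = r ^ i * (of_nat (n - Suc i * M N) * ?e l + of_nat (M N - l) * ?e l)"
      by (simp only: of_nat_add) (simp add: algebra_simps)
  qed
  also have "\<dots> = (\<Sum>i<j. r ^ i) * fejer_ker (M N) t x
     + (\<Sum>i<j. r ^ i * of_nat (n - Suc i * M N)) * (\<Sum>l<M N. ?e l)"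
    by (simp only: sum_distrib_right sum.distrib[symmetric]) (simp add: algebra_simps)
  finally show ?thesis .
qed

text \<open>\<open>M N\<close> times the Dirichlet kernel of order \<open>M N\<close> at
  \<open>x - t\<close>. The extra factor accounts for the weights \<open>n - Suc i * M N\<close>,
  which are at most \<open>B * M N\<close> for \<open>n \<le> M (Suc N)\<close>.\<close>

definition dirichlet_bd :: "nat \<Rightarrow> (nat \<Rightarrow> nat) \<Rightarrow> (nat \<Rightarrow> nat) \<Rightarrow> real" where
  "dirichlet_bd N t x = (if \<forall>k<N. x k = t k then real (M N) ^ 2 else 0)"

lemma fejer_ker_middle_le:
  assumes "j \<le> m N" "n \<le> M (Suc N)" "x \<in> G" "t \<in> G" "cmod r = 1"
  shows "cmod ((\<Sum>i<j. r ^ i * of_nat (n - Suc i * M N)) * (\<Sum>l<M N. \<psi> l x * cnj (\<psi> l t)))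
      \<le> real B ^ 2 * dirichlet_bd N t x"
proof -
  have n: "real n \<le> real B * real (M N)"
    using assms(2) M_Suc_le[of N] by (metis of_nat_le_iff of_nat_mult order_trans)
  have j: "real j \<le> real B" using assms(1) m_le[of N] by simp
  have "cmod (\<Sum>i<j. r ^ i * of_nat (n - Suc i * M N)) \<le> (\<Sum>i<j. real n)"
    by (rule sum_norm_le) (simp add: norm_mult norm_power assms(5))
  also have "\<dots> \<le> real B * (real B * real (M N))"
    using n j by (simp add: mult_mono)
  finally have "cmod (\<Sum>i<j. r ^ i * of_nat (n - Suc i * M N)) * cmod (\<Sum>l<M N. \<psi> l x * cnj (\<psi> l t))
    \<le> real B * (real B * real (M N)) * cmod (\<Sum>l<M N. \<psi> l x * cnj (\<psi> l t))"
    by (rule mult_right_mono) simp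
  moreover have "real (M N) * cmod (\<Sum>l<M N. \<psi> l x * cnj (\<psi> l t)) = dirichlet_bd N t x"
    unfolding dirichlet_kernel[OF assms(3,4)] dirichlet_bd_def
    by (simp only: if_distrib[of cmod] if_distrib[of "(*) _"] norm_of_nat norm_zero mult_zero_right power2_eq_square)
  ultimately show ?thesis
    by (simp only: norm_mult power2_eq_square mult.assoc)
qed

lemma cmod_ratio: "cmod (rademacher m N x * cnj (rademacher m N t)) = 1"
  by (simp add: norm_mult cmod_rademacher)

text \<open>Removing the leading digit of the order leaves an incomplete geometric sum, which is
  bounded by its number of terms.\<close>

lemma fejer_ker_le:
  assumes "j < m N" "i0 < M N" "x \<in> G" "t \<in> G"
  shows "cmod (fejer_ker (j * M N + i0) t x)
    \<le> real B * cmod (fejer_ker (M N) t x) + real B ^ 2 * dirichlet_bd N t x + cmod (fejer_ker i0 t x)"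
proof -
  let ?r = "rademacher m N x * cnj (rademacher m N t)"
  have "j * M N + i0 \<le> Suc j * M N" using assms by simp
  also have "\<dots> \<le> M (Suc N)"
    unfolding vil_M_simps using assms by (intro mult_right_mono) auto
  finally have n: "j * M N + i0 \<le> M (Suc N)" .
  have "cmod (\<Sum>i<j. ?r ^ i) \<le> (\<Sum>i<j. 1)"
    by (rule sum_norm_le) (simp add: norm_power cmod_ratio)
  also have "\<dots> \<le> real B" using assms(1) m_le[of N] by simp
  finally have "cmod ((\<Sum>i<j. ?r ^ i) * fejer_ker (M N) t x) \<le> real B * cmod (fejer_ker (M N) t x)"
    unfolding norm_mult by (rule mult_right_mono) simp
  moreover note fejer_ker_middle_le[OF less_imp_le[OF assms(1)] n assms(3,4) cmod_ratio]
  moreover have "cmod (?r ^ j * fejer_ker i0 t x) = cmod (fejer_ker i0 t x)"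
    by (simp only: norm_mult[of "_ ^ _"] norm_power cmod_ratio) simp
  ultimately show ?thesis
    using assms by (subst fejer_ker_split) (auto intro!: norm_triangle_le add_mono)
qed

text \<open>Here the geometric sum runs over a full period, so the Fejer part survives only where
  digit \<open>N\<close> of \<open>x\<close> and \<open>t\<close> agree. This localisation makes the
  recursion for the orders \<open>M N\<close> contracting in \<open>L_p\<close>.\<close>

lemma fejer_ker_M_Suc_le:
  assumes "x \<in> G" "t \<in> G"
  shows "cmod (fejer_ker (M (Suc N)) t x)
    \<le> (if x N = t N then real (m N) * cmod (fejer_ker (M N) t x) else 0) + real B ^ 2 * dirichlet_bd N t x"
proof -
  let ?r = "rademacher m N x * cnj (rademacher m N t)"
  have "fejer_ker (m N * M N + 0) t x = (\<Sum>i<m N. ?r ^ i) * fejer_ker (M N) t x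
     + (\<Sum>i<m N. ?r ^ i * of_nat (m N * M N + 0 - Suc i * M N)) * (\<Sum>l<M N. \<psi> l x * cnj (\<psi> l t))
     + ?r ^ m N * fejer_ker 0 t x"
    using M_pos by (intro fejer_ker_split) auto
  also have "?r ^ m N * fejer_ker 0 t x = 0" by (simp add: fejer_ker_def)
  finally have "cmod (fejer_ker (m N * M N + 0) t x) \<le> cmod ((\<Sum>i<m N. ?r ^ i) * fejer_ker (M N) t x)
     + cmod ((\<Sum>i<m N. ?r ^ i * of_nat (m N * M N + 0 - Suc i * M N)) * (\<Sum>l<M N. \<psi> l x * cnj (\<psi> l t)))"
    by (simp only: add_0_right norm_triangle_ineq)
  also have "cmod ((\<Sum>i<m N. ?r ^ i) * fejer_ker (M N) t x)
      = (if x N = t N then real (m N) * cmod (fejer_ker (M N) t x) else 0)"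
    by (simp add: sum_powers_rademacher[OF assms] norm_mult)
  also have "cmod ((\<Sum>i<m N. ?r ^ i * of_nat (m N * M N + 0 - Suc i * M N)) * (\<Sum>l<M N. \<psi> l x * cnj (\<psi> l t)))
    \<le> real B ^ 2 * dirichlet_bd N t x"
    by (intro fejer_ker_middle_le assms cmod_ratio) (auto simp: vil_M_simps)
  finally show ?thesis by (simp add: vil_M_simps)
qed

lemma level_dirichlet_bd: "level N (dirichlet_bd N t)"
  by (rule levelI) (simp add: dirichlet_bd_def)

text \<open>A coset measure \<open>1 / M N\<close> is multiplied by \<open>M N\<close> to the power
  \<open>2 * p\<close>; the resulting exponent is negative precisely for
  \<open>p < 1 / 2\<close>.\<close>

lemma integral_dirichlet_bd:
  assumes "t \<in> G"
  shows "(LINT x|\<mu>. dirichlet_bd N t x powr p) = real (M N) powr (2 * p - 1)"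
proof -
  have "(LINT x|\<mu>. dirichlet_bd N t x powr p)
      = (LINT x|\<mu>. indicator (vil_interval m N t) x * ((real (M N) ^ 2) powr p))"
    by (intro Bochner_Integration.integral_cong)
       (auto simp: dirichlet_bd_def vil_interval_def space_vil_haar indicator_def)
  also have "\<dots> = measure \<mu> (vil_interval m N t) * (real (M N) ^ 2) powr p"
    by (simp add: vil_interval_in_sets sets.Int_space_eq2)
  also have "real (M N) ^ 2 = real (M N) powr 2"
    using M_pos[of N] by (intro powr_numeral[symmetric]) simp
  also have "measure \<mu> (vil_interval m N t) * (real (M N) powr 2) powr p
      = (real (M N) powr 2) powr p / real (M N)"
    by (simp only: measure_interval[OF assms] times_divide_eq_left mult_1_left)
  also have "\<dots> = real (M N) powr (2 * p - 1)"
    by (simp only: powr_powr powr_diff powr_one of_nat_0_le_iff)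
  finally show ?thesis .
qed

lemma level_restrict: "level N g \<Longrightarrow> level (Suc N) (\<lambda>x. if x N = a then g x else b)"
  unfolding level_def by (metis less_Suc_eq)

text \<open>Under the Haar measure digit \<open>N\<close> is uniform on \<open>m N\<close> values
  and independent of the first \<open>N\<close> digits, on which \<open>g\<close> depends.\<close>

lemma integral_restrict:
  fixes g :: "(nat \<Rightarrow> nat) \<Rightarrow> real"
  assumes g: "level N g" and t: "t \<in> G"
  shows "(LINT x|\<mu>. (if x N = t N then g x else 0)) = (LINT x|\<mu>. g x) / real (m N)"
proof -
  have "(\<Sum>u<M (Suc N). if pt u N = t N then g (pt u) else 0)
    = (\<Sum>j<m N. \<Sum>i<M N. if j = t N then g (pt i) else 0)"
    unfolding vil_M_simps sum_lessThan_mult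
  proof (intro sum.cong refl)
    fix j i assume *: "j \<in> {..<m N}" "i \<in> {..<M N}"
    have "g (pt (j * M N + i)) = g (pt i)"
      using * by (intro levelD[OF g] pt_in_G) (simp add: pt_add)
    moreover have "pt (j * M N + i) N = j" using * by (intro pt_add) auto
    ultimately show "(if pt (j * M N + i) N = t N then g (pt (j * M N + i)) else 0) = (if j = t N then g (pt i) else 0)"
      by (simp only:)
  qed
  also have "\<dots> = (\<Sum>i<M N. g (pt i))"
    by (subst sum.swap) (simp add: G_less[OF t])
  finally have "(LINT x|\<mu>. (if x N = t N then g x else 0)) = (\<Sum>i<M N. g (pt i)) / real (M (Suc N))"
    by (subst integral_level[OF level_restrict[OF g]]) simp
  then show ?thesis
    by (simp add: integral_level[OF g] vil_M_simps)
qed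

lemma Lp_pow_cmult: "Lp_pow p (\<lambda>x. a * g x) = cmod a powr p * Lp_pow p g"
  by (simp add: Lp_pow_def norm_mult powr_mult)

lemma Hp_pow_cong_cmod:
  assumes "\<And>k x. cmod (f k x) = cmod (g k x)"
  shows "Hp_pow p f = Hp_pow p g"
  by (simp add: Hp_pow_def maximal_fun_def assms)

end

section \<open>The uniform bound for the Fejer kernels when \<open>p < 1 / 2\<close>\<close>

locale vilenkin_p = vilenkin +
  fixes p :: real
  assumes p_pos: "0 < p" and p_less: "p < 1 / 2"
begin

text \<open>The factor \<open>m N\<close> of the Fejer part contributes \<open>m N powr p\<close>,
  while fixing one digit divides the integral by \<open>m N\<close>; the resulting
  \<open>m N powr (p - 1)\<close> is below 1.\<close>

lemma Lp_pow_fejer_ker_M_Suc_le: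
  assumes "t \<in> G"
  shows "Lp_pow p (fejer_ker (M (Suc N)) t) \<le> real (m N) powr (p - 1) * Lp_pow p (fejer_ker (M N) t)
     + (real B ^ 2) powr p * real (M N) powr (2 * p - 1)"
proof -
  let ?L = "\<lambda>n x. cmod (fejer_ker n t x) powr p"
  have lev: "level N (?L (M N))" by (rule level_compose[OF level_fejer_ker]) simp
  have lev': "level N (\<lambda>x. real (m N) powr p * ?L (M N) x)" by (rule level_compose[OF lev])
  have lev1: "level (Suc N) (\<lambda>x. if x N = t N then real (m N) powr p * ?L (M N) x else 0)"
    by (rule level_restrict[OF lev'])
  have lev2: "level N (\<lambda>x. (real B ^ 2) powr p * dirichlet_bd N t x powr p)"
    by (rule level_compose[OF level_dirichlet_bd])
  have "Lp_pow p (fejer_ker (M (Suc N)) t) \<le> (LINT x|\<mu>. (if x N = t N then real (m N) powr p * ?L (M N) x else 0)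
      + (real B ^ 2) powr p * dirichlet_bd N t x powr p)"
    unfolding Lp_pow_def
  proof (rule integral_mono)
    show "integrable \<mu> (?L (M (Suc N)))"
      by (rule integrable_level[OF level_compose[OF level_fejer_ker[OF order_refl]]])
    show "integrable \<mu> (\<lambda>x. (if x N = t N then real (m N) powr p * ?L (M N) x else 0)
      + (real B ^ 2) powr p * dirichlet_bd N t x powr p)"
      by (intro Bochner_Integration.integrable_add integrable_level[OF lev1] integrable_level[OF lev2])
    fix x assume "x \<in> space \<mu>"
    then have "?L (M (Suc N)) x \<le> ((if x N = t N then real (m N) * cmod (fejer_ker (M N) t x) else 0)
        + real B ^ 2 * dirichlet_bd N t x) powr p"
      using p_pos assms by (intro powr_mono2 fejer_ker_M_Suc_le) (auto simp: space_vil_haar)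
    also have "\<dots> \<le> (if x N = t N then real (m N) * cmod (fejer_ker (M N) t x) else 0) powr p
        + (real B ^ 2 * dirichlet_bd N t x) powr p"
      using p_pos p_less by (intro powr_add_le) (auto simp: dirichlet_bd_def)
    also have "\<dots> = (if x N = t N then real (m N) powr p * ?L (M N) x else 0)
      + (real B ^ 2) powr p * dirichlet_bd N t x powr p"
      using p_pos by (simp add: powr_mult dirichlet_bd_def)
    finally show "?L (M (Suc N)) x \<le> (if x N = t N then real (m N) powr p * ?L (M N) x else 0)
      + (real B ^ 2) powr p * dirichlet_bd N t x powr p" .
  qed
  also have "\<dots> = (LINT x|\<mu>. (if x N = t N then real (m N) powr p * ?L (M N) x else 0))
      + (LINT x|\<mu>. (real B ^ 2) powr p * dirichlet_bd N t x powr p)"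
    by (intro Bochner_Integration.integral_add integrable_level[OF lev1] integrable_level[OF lev2])
  also have "(LINT x|\<mu>. (if x N = t N then real (m N) powr p * ?L (M N) x else 0))
      = real (m N) powr p * Lp_pow p (fejer_ker (M N) t) / real (m N)"
    unfolding integral_restrict[OF lev' assms] Lp_pow_def by simp
  also have "\<dots> = real (m N) powr (p - 1) * Lp_pow p (fejer_ker (M N) t)"
    using m_pos[of N] by (simp add: powr_diff)
  also have "(LINT x|\<mu>. (real B ^ 2) powr p * dirichlet_bd N t x powr p)
      = (real B ^ 2) powr p * real (M N) powr (2 * p - 1)"
    by (simp add: integral_dirichlet_bd[OF assms])
  finally show ?thesis .
qed

text \<open>Any constant \<open>K\<close> with \<open>a\<^sup>p\<^sup>-\<^sup>1 K + (B\<^sup>2)\<^sup>p \<le> a\<^sup>2\<^sup>p\<^sup>-\<^sup>1 K\<close> for \<open>2 \<le> a \<le> B\<close> closes the induction below.\<close>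

definition ker_const :: real where
  "ker_const = max 1 ((real B ^ 2) powr p / (real B powr (p - 1) * (2 powr p - 1)))"

text \<open>The Fejer part contracts by \<open>m N powr (p - 1)\<close>, faster than the
  \<open>m N powr (2 * p - 1)\<close> allowed per level; the gap between the two absorbs the
  Dirichlet term.\<close>

lemma Lp_pow_fejer_ker_M_le:
  assumes "t \<in> G"
  shows "Lp_pow p (fejer_ker (M N) t) \<le> ker_const * real (M N) powr (2 * p - 1)"
proof (induction N)
  case 0
  \<comment> \<open>The kernel of order 1 is constant; this case needs
    \<open>1 \<le> ker_const\<close>.\<close>
  have "fejer_ker (M 0) t x = 1" for x
    by (simp add: fejer_ker_def vil_M_simps psi_0)
  then have "Lp_pow p (fejer_ker (M 0) t) = 1"
    by (simp add: Lp_pow_def prob_space.prob_space[OF prob_space_vil_haar[OF m_all]])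
  then show ?case by (simp add: vil_M_simps ker_const_def)
next
  case (Suc N)
  let ?K = ker_const and ?C = "(real B ^ 2) powr p" and ?m = "real (m N)"
  have m2: "2 \<le> ?m" "?m \<le> real B" using m_ge_2[of N] m_le[of N] by auto
  have "1 = 2 powr (0::real)" by simp
  also have "\<dots> < 2 powr p" using p_pos by (intro powr_less_mono) auto
  finally have p2: "1 < 2 powr p" .
  \<comment> \<open>A lower bound for the gap \<open>a powr (2 * p - 1) - a powr (p - 1) = a powr (p
    - 1) * (a powr p - 1)\<close> over \<open>2 \<le> a \<le> B\<close>: the first factor is least
    at \<open>B\<close>, the second at 2.\<close>
  define b where "b = real B powr (p - 1) * (2 powr p - 1)"
  have b: "0 < b"
    using p2 B_ge_2 by (simp add: b_def)
  have "?C = ?C / b * b"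
    using b by simp
  also have "\<dots> \<le> ?K * b"
    using b by (intro mult_right_mono) (auto simp: ker_const_def b_def)
  also have "\<dots> \<le> ?K * (?m powr (p - 1) * (?m powr p - 1))"
    using m2 p2 p_pos p_less
    unfolding b_def
  proof (intro mult_left_mono mult_mono)
    show "real B powr (p - 1) \<le> ?m powr (p - 1)"
      using m2 p_less by (intro powr_mono2') auto
    show "2 powr p - 1 \<le> ?m powr p - 1"
      using m2 p_pos by (intro diff_right_mono powr_mono2) auto
    show "0 \<le> 2 powr p - 1" using p2 by linarith
  qed (auto simp: ker_const_def)
  also have "\<dots> = ?K * ?m powr (2 * p - 1) - ?m powr (p - 1) * ?K"
    using powr_add[of ?m "p - 1" p] by (simp add: algebra_simps)
  finally have K: "?m powr (p - 1) * ?K + ?C \<le> ?K * ?m powr (2 * p - 1)" by simp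
  have "Lp_pow p (fejer_ker (M (Suc N)) t)
      \<le> ?m powr (p - 1) * (?K * real (M N) powr (2 * p - 1)) + ?C * real (M N) powr (2 * p - 1)"
    using Lp_pow_fejer_ker_M_Suc_le[OF assms, of N] Suc mult_left_mono[OF Suc, of "?m powr (p - 1)"] by simp
  also have "\<dots> = (?m powr (p - 1) * ?K + ?C) * real (M N) powr (2 * p - 1)"
    by (simp add: algebra_simps)
  also have "\<dots> \<le> ?K * ?m powr (2 * p - 1) * real (M N) powr (2 * p - 1)"
    using K by (rule mult_right_mono) simp
  also have "\<dots> = ?K * real (M (Suc N)) powr (2 * p - 1)"
    by (simp add: vil_M_simps powr_mult)
  finally show ?case .
qed

text \<open>The slowest possible decay of \<open>M k powr (2 * p - 1)\<close> from one level to the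
  next, belonging to \<open>m k = 2\<close>.\<close>

definition theta :: real where
  "theta = 2 powr (2 * p - 1)"

lemma theta: "0 < theta" "theta < 1"
proof -
  have "2 powr (2 * p - 1) < 2 powr (0::real)" using p_less by (intro powr_less_mono) auto
  then show "theta < 1" by (simp add: theta_def)
qed (simp add: theta_def)

lemma M_powr_le: "real (M (i + k)) powr (2 * p - 1) \<le> real (M i) powr (2 * p - 1) * theta ^ k"
proof -
  have "real (2 ^ k * M i) \<le> real (M (i + k))"
    using M_add_ge[of k i] by (subst of_nat_le_iff)
  then have "real (M (i + k)) powr (2 * p - 1) \<le> real (2 ^ k * M i) powr (2 * p - 1)"
    using M_pos p_less by (intro powr_mono2') auto
  also have "\<dots> = (2 ^ k) powr (2 * p - 1) * real (M i) powr (2 * p - 1)"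
    by (simp add: powr_mult)
  also have "(2 ^ k) powr (2 * p - 1) = theta ^ k"
    unfolding theta_def by (simp add: powr_realpow[symmetric] powr_powr mult.commute)
  finally show ?thesis by (simp add: mult.commute)
qed

text \<open>Removing the leading digit of \<open>n\<close> costs a multiple of
  \<open>M N powr (2 * p - 1)\<close>, which is at most \<open>theta ^ N\<close>, and leaves a
  kernel of order below \<open>M N\<close>. The costs form a geometric series, whence a bound
  independent of \<open>n\<close>.\<close>

lemma Lp_pow_fejer_ker_le_sum:
  assumes "t \<in> G"
  shows "n < M N \<Longrightarrow> Lp_pow p (fejer_ker n t)
    \<le> (real B powr p * ker_const + (real B ^ 2) powr p) * (\<Sum>k<N. theta ^ k)"
proof (induction N arbitrary: n)
  case 0
  then show ?case by (simp add: vil_M_simps fejer_ker_def Lp_pow_def)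
next
  case (Suc N)
  let ?C = "(real B ^ 2) powr p"
  define j i0 where "j = n div M N" and "i0 = n mod M N"
  have n: "n = j * M N + i0" unfolding j_def i0_def by (rule div_mult_mod_eq[symmetric])
  have i0: "i0 < M N" using M_pos by (simp add: i0_def)
  have j: "j < m N"
    using Suc.prems by (simp add: j_def vil_M_simps less_mult_imp_div_less)
  let ?L = "\<lambda>n x. cmod (fejer_ker n t x) powr p"
  have int: "integrable \<mu> (?L k)" for k
    by (rule integrable_level[OF level_compose[OF level_fejer_ker[of k k]]])
      (use vil_M_gt[OF m_all, of k] in simp)
  have intd: "integrable \<mu> (\<lambda>x. dirichlet_bd N t x powr p)"
    by (rule integrable_level[OF level_compose[OF level_dirichlet_bd]])
  have "Lp_pow p (fejer_ker n t) \<le> (LINT x|\<mu>. real B powr p * ?L (M N) x + ?C * dirichlet_bd N t x powr p + ?L i0 x)"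
    unfolding Lp_pow_def
  proof (rule integral_mono)
    show "integrable \<mu> (\<lambda>x. real B powr p * ?L (M N) x + ?C * dirichlet_bd N t x powr p + ?L i0 x)"
      by (intro Bochner_Integration.integrable_add integrable_mult_right int intd)
    fix x assume "x \<in> space \<mu>"
    then have "?L n x \<le> (real B * cmod (fejer_ker (M N) t x) + real B ^ 2 * dirichlet_bd N t x
        + cmod (fejer_ker i0 t x)) powr p"
      unfolding n using p_pos assms i0 j by (intro powr_mono2 fejer_ker_le) (auto simp: space_vil_haar)
    also have "\<dots> \<le> (real B * cmod (fejer_ker (M N) t x) + real B ^ 2 * dirichlet_bd N t x) powr p + ?L i0 x"
      using p_pos p_less by (intro powr_add_le) (auto simp: dirichlet_bd_def)
    also have "\<dots> \<le> (real B * cmod (fejer_ker (M N) t x)) powr p + (real B ^ 2 * dirichlet_bd N t x) powr p + ?L i0 x"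
      using p_pos p_less by (intro add_right_mono powr_add_le) (auto simp: dirichlet_bd_def)
    also have "\<dots> = real B powr p * ?L (M N) x + ?C * dirichlet_bd N t x powr p + ?L i0 x"
      by (simp add: powr_mult dirichlet_bd_def)
    finally show "?L n x \<le> real B powr p * ?L (M N) x + ?C * dirichlet_bd N t x powr p + ?L i0 x" .
  qed (rule int)
  also have "\<dots> = real B powr p * Lp_pow p (fejer_ker (M N) t) + ?C * real (M N) powr (2 * p - 1) + Lp_pow p (fejer_ker i0 t)"
    using int intd by (simp add: Lp_pow_def integral_dirichlet_bd[OF assms])
  also have "\<dots> \<le> real B powr p * (ker_const * real (M N) powr (2 * p - 1)) + ?C * real (M N) powr (2 * p - 1)
      + (real B powr p * ker_const + ?C) * (\<Sum>k<N. theta ^ k)"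
    using Suc.IH[OF i0] Lp_pow_fejer_ker_M_le[OF assms, of N] by (intro add_mono mult_left_mono) auto
  also have "\<dots> = (real B powr p * ker_const + ?C) * (real (M N) powr (2 * p - 1) + (\<Sum>k<N. theta ^ k))"
    by (simp add: algebra_simps)
  also have "\<dots> \<le> (real B powr p * ker_const + ?C) * (theta ^ N + (\<Sum>k<N. theta ^ k))"
    using M_powr_le[of 0 N] by (intro mult_left_mono) (auto simp: vil_M_simps ker_const_def)
  finally show ?case by (simp add: add.commute)
qed

definition fejer_const :: real where
  "fejer_const = (real B powr p * ker_const + (real B ^ 2) powr p) / (1 - theta)"

lemma fejer_const_nonneg: "0 \<le> fejer_const"
  using theta by (simp add: fejer_const_def ker_const_def)

lemma Lp_pow_fejer_ker_le:
  assumes "t \<in> G"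
  shows "Lp_pow p (fejer_ker n t) \<le> fejer_const"
proof -
  have "(\<Sum>k<n. theta ^ k) \<le> (\<Sum>k. theta ^ k)"
    using theta by (intro sum_le_suminf) (auto intro: summable_geometric)
  then have "(\<Sum>k<n. theta ^ k) \<le> 1 / (1 - theta)"
    using theta by (simp add: suminf_geometric)
  then have "(real B powr p * ker_const + (real B ^ 2) powr p) * (\<Sum>k<n. theta ^ k) \<le> fejer_const"
    unfolding fejer_const_def divide_inverse[of _ "1 - theta"]
    by (intro mult_left_mono) (auto simp: ker_const_def inverse_eq_divide)
  with Lp_pow_fejer_ker_le_sum[OF assms vil_M_gt[OF m_all]] show ?thesis
    by (rule order_trans)
qed

section \<open>Fejer means of single blocks and of martingales\<close>

text \<open>The function \<open>trig d N\<close> is constant on cosets, so its convolution with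
  \<open>n K_n\<close> has only \<open>M N\<close> terms. Subadditivity of the \<open>p\<close>-th
  power turns each weight \<open>1 / M N\<close> into \<open>1 / M N powr p\<close>, which accounts
  for the loss \<open>M N powr (1 - p)\<close>.\<close>

lemma Lp_pow_fejer_sum_le:
  assumes "n \<le> M N"
  shows "Lp_pow p (\<lambda>x. \<Sum>i<n. of_nat (n - i) * d i * \<psi> i x)
    \<le> fejer_const * real (M N) powr (1 - p) * Lp_pow p (trig d N)"
proof -
  let ?h = "trig d N" and ?w = "\<lambda>x. \<Sum>i<n. of_nat (n - i) * d i * \<psi> i x"
  have M: "0 < real (M N)" using M_pos by simp
  have d: "d i = (\<Sum>u<M N. ?h (pt u) * cnj (\<psi> i (pt u))) / of_nat (M N)" if "i < M N" for i
  proof -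
    have "d i = fourier_coeff m ?h i" using that by (simp add: fourier_coeff_trig)
    also have "\<dots> = (\<Sum>u<M N. ?h (pt u) * cnj (\<psi> i (pt u))) / of_nat (M N)"
      unfolding fourier_coeff_def
      by (subst integral_level[OF level_compose2[OF level_trig level_psi[OF that], of "\<lambda>a b. a * cnj b"]])
         (simp add: scaleR_conv_of_real)
    finally show ?thesis .
  qed
  \<comment> \<open>Inserting the averages for the coefficients and exchanging the sums exhibits a
    combination of \<open>M N\<close> translated kernels.\<close>
  have w: "?w x = (\<Sum>u<M N. ?h (pt u) / of_nat (M N) * fejer_ker n (pt u) x)" for x
  proof -
    have "?w x = (\<Sum>i<n. \<Sum>u<M N. of_nat (n - i) * (?h (pt u) * cnj (\<psi> i (pt u)) / of_nat (M N)) * \<psi> i x)"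
      using assms by (intro sum.cong refl) (simp add: d sum_divide_distrib sum_distrib_left sum_distrib_right)
    also have "\<dots> = (\<Sum>u<M N. ?h (pt u) / of_nat (M N) * fejer_ker n (pt u) x)"
      unfolding fejer_ker_def sum_distrib_left by (subst sum.swap) (simp add: mult_ac)
    finally show ?thesis .
  qed
  have int: "integrable \<mu> (\<lambda>x. cmod (fejer_ker n t x) powr p)" for t
    by (rule integrable_level[OF level_compose[OF level_fejer_ker[OF assms]]])
  have "Lp_pow p ?w \<le> (LINT x|\<mu>. (\<Sum>u<M N. (cmod (?h (pt u)) / real (M N)) powr p * cmod (fejer_ker n (pt u) x) powr p))"
    unfolding Lp_pow_def
  proof (rule integral_mono)
    show "integrable \<mu> (\<lambda>x. cmod (?w x) powr p)"
      by (rule integrable_level[OF level_compose[OF level_sum_psi[OF assms]]])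
    show "integrable \<mu> (\<lambda>x. \<Sum>u<M N. (cmod (?h (pt u)) / real (M N)) powr p * cmod (fejer_ker n (pt u) x) powr p)"
      by (intro Bochner_Integration.integrable_sum integrable_mult_right int)
    fix x
    have "cmod (?w x) \<le> (\<Sum>u<M N. cmod (?h (pt u)) / real (M N) * cmod (fejer_ker n (pt u) x))"
      unfolding w by (rule sum_norm_le) (simp add: norm_mult norm_divide)
    then have "cmod (?w x) powr p \<le> (\<Sum>u<M N. cmod (?h (pt u)) / real (M N) * cmod (fejer_ker n (pt u) x)) powr p"
      using p_pos by (intro powr_mono2) auto
    also have "\<dots> \<le> (\<Sum>u<M N. (cmod (?h (pt u)) / real (M N) * cmod (fejer_ker n (pt u) x)) powr p)"
      using p_pos p_less by (intro powr_sum_le) auto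
    also have "\<dots> = (\<Sum>u<M N. (cmod (?h (pt u)) / real (M N)) powr p * cmod (fejer_ker n (pt u) x) powr p)"
      by (intro sum.cong refl powr_mult)
    finally show "cmod (?w x) powr p
      \<le> (\<Sum>u<M N. (cmod (?h (pt u)) / real (M N)) powr p * cmod (fejer_ker n (pt u) x) powr p)" .
  qed
  also have "\<dots> = (\<Sum>u<M N. (cmod (?h (pt u)) / real (M N)) powr p * Lp_pow p (fejer_ker n (pt u)))"
    using int by (simp add: Lp_pow_def)
  also have "\<dots> \<le> (\<Sum>u<M N. (cmod (?h (pt u)) / real (M N)) powr p * fejer_const)"
    by (intro sum_mono mult_left_mono Lp_pow_fejer_ker_le pt_in_G) auto
  also have "\<dots> = fejer_const * (\<Sum>u<M N. cmod (?h (pt u)) powr p) / real (M N) powr p"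
    by (simp add: powr_divide sum_divide_distrib sum_distrib_left mult_ac)
  also have "\<dots> = fejer_const * real (M N) powr (1 - p) * Lp_pow p ?h"
    using M by (simp add: Lp_pow_level[OF level_trig] powr_diff)
  finally show ?thesis .
qed

text \<open>For \<open>i < q\<close> the multiplier is \<open>1 - (q - i) / q\<close>, and from
  \<open>q\<close> on it is 1, so the block changes by a Fejer sum divided by \<open>q\<close>. The
  loss \<open>M (Suc k) powr (1 - p)\<close> over \<open>q powr p\<close> is of order
  \<open>M k powr (1 - 2 * p)\<close>.\<close>

lemma Lp_pow_blk_multiplier_le:
  assumes q: "M k \<le> q" "q \<le> M (Suc k)"
  shows "Lp_pow p (blk (\<lambda>i. of_nat (min i q) / of_nat q * c i) k)
    \<le> (1 + fejer_const * real B) * (real (M k) powr (1 - 2 * p) * Lp_pow p (blk c k))"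
proof -
  let ?d = "tail k c" and ?w = "\<lambda>x. \<Sum>i<q. of_nat (q - i) * tail k c i * \<psi> i x"
  let ?b = "\<lambda>i. of_nat (min i q) / of_nat q * c i"
  have q0: "0 < q" using M_pos[of k] q by simp
  have B1: "1 \<le> real B" using B_ge_2 by simp
  have eq: "blk ?b k x = blk c k x - ?w x / of_nat q" for x
  proof -
    have "blk ?b k x = (\<Sum>i<M (Suc k). tail k ?b i * \<psi> i x)"
      by (simp add: blk_eq_trig trig_def)
    also have "\<dots> = (\<Sum>i<M (Suc k). ?d i * \<psi> i x - (if i < q then of_nat (q - i) * ?d i * \<psi> i x else 0) / of_nat q)"
      using q0 by (intro sum.cong refl)
        (auto simp: tail_def min_def field_simps of_nat_diff)
    also have "\<dots> = blk c k x - (\<Sum>i<M (Suc k). if i < q then of_nat (q - i) * ?d i * \<psi> i x else 0) / of_nat q"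
      by (simp add: blk_eq_trig trig_def sum_subtractf sum_divide_distrib)
    also have "(\<Sum>i<M (Suc k). if i < q then of_nat (q - i) * ?d i * \<psi> i x else 0) = ?w x"
      by (rule sum.mono_neutral_cong_right) (use q in auto)
    finally show ?thesis .
  qed
  have intb: "integrable \<mu> (\<lambda>x. cmod (blk c k x) powr p)"
    by (rule integrable_level[OF level_compose[OF level_blk]])
  have intw: "integrable \<mu> (\<lambda>x. cmod (?w x) powr p)"
    by (rule integrable_level[OF level_compose[OF level_sum_psi[OF q(2)]]])
  have "Lp_pow p (blk ?b k) \<le> (LINT x|\<mu>. cmod (blk c k x) powr p + cmod (?w x) powr p / real q powr p)"
    unfolding Lp_pow_def
  proof (rule integral_mono)
    show "integrable \<mu> (\<lambda>x. cmod (blk ?b k x) powr p)"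
      by (rule integrable_level[OF level_compose[OF level_blk]])
    show "integrable \<mu> (\<lambda>x. cmod (blk c k x) powr p + cmod (?w x) powr p / real q powr p)"
      using intb intw by simp
    fix x
    have "cmod (blk ?b k x) \<le> cmod (blk c k x) + cmod (?w x) / real q"
      unfolding eq using norm_triangle_ineq4[of "blk c k x" "?w x / of_nat q"] by (simp add: norm_divide)
    then have "cmod (blk ?b k x) powr p \<le> (cmod (blk c k x) + cmod (?w x) / real q) powr p"
      using p_pos by (intro powr_mono2) auto
    also have "\<dots> \<le> cmod (blk c k x) powr p + (cmod (?w x) / real q) powr p"
      using p_pos p_less by (intro powr_add_le) auto
    finally show "cmod (blk ?b k x) powr p \<le> cmod (blk c k x) powr p + cmod (?w x) powr p / real q powr p"
      by (simp add: powr_divide)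
  qed
  also have "\<dots> = Lp_pow p (blk c k) + Lp_pow p ?w / real q powr p"
    using intb intw by (simp add: Lp_pow_def)
  also have "\<dots> \<le> Lp_pow p (blk c k) + (fejer_const * real (M (Suc k)) powr (1 - p) * Lp_pow p (blk c k)) / real (M k) powr p"
  proof (intro add_left_mono frac_le)
    have "Lp_pow p (blk c k) = Lp_pow p (trig ?d (Suc k))"
      by (simp add: Lp_pow_def blk_eq_trig)
    then show "Lp_pow p ?w \<le> fejer_const * real (M (Suc k)) powr (1 - p) * Lp_pow p (blk c k)"
      using Lp_pow_fejer_sum_le[OF q(2), of ?d] by simp
    show "real (M k) powr p \<le> real q powr p"
      using q p_pos by (intro powr_mono2) auto
  qed (use M_pos[of k] fejer_const_nonneg in \<open>auto simp: Lp_pow_nonneg\<close>)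
  also have "\<dots> \<le> Lp_pow p (blk c k) + (fejer_const * (real B * real (M k) powr (1 - p)) * Lp_pow p (blk c k)) / real (M k) powr p"
  proof (intro add_left_mono divide_right_mono mult_right_mono mult_left_mono)
    have "real (M (Suc k)) powr (1 - p) \<le> (real B * real (M k)) powr (1 - p)"
      using p_less M_Suc_le[of k] by (intro powr_mono2) (auto simp flip: of_nat_mult)
    also have "\<dots> = real B powr (1 - p) * real (M k) powr (1 - p)"
      by (simp add: powr_mult)
    also have "\<dots> \<le> real B powr 1 * real (M k) powr (1 - p)"
      using B1 p_pos by (intro mult_right_mono powr_mono) auto
    finally show "real (M (Suc k)) powr (1 - p) \<le> real B * real (M k) powr (1 - p)"
      using B1 by simp
  qed (use fejer_const_nonneg in \<open>auto simp: Lp_pow_nonneg\<close>)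
  also have "\<dots> = Lp_pow p (blk c k) * 1 + fejer_const * real B * (real (M k) powr (1 - 2 * p) * Lp_pow p (blk c k))"
    using powr_diff[of "real (M k)" "1 - p" p] by (simp add: mult_ac)
  \<comment> \<open>As \<open>1 - 2 * p\<close> is positive and \<open>M k\<close> is at least 1,
    the first term can be merged into the second.\<close>
  also have "Lp_pow p (blk c k) * 1 \<le> Lp_pow p (blk c k) * real (M k) powr (1 - 2 * p)"
    using M_ge_1[of k] p_less by (intro mult_left_mono ge_one_powr_ge_zero Lp_pow_nonneg) auto
  finally show ?thesis by (simp add: algebra_simps)
qed

text \<open>On block \<open>k\<close> capping the index at \<open>n\<close> is capping it at
  \<open>q = min n (M (Suc k))\<close>. The error multiplier is therefore \<open>- q / n\<close>
  times the one for \<open>q\<close>, and \<open>q / n\<close> is at most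
  \<open>B * M k / M N\<close>, which decays geometrically in \<open>N - k\<close>.\<close>

lemma Lp_pow_blk_fejer_err_le:
  assumes "k \<le> N" "M N \<le> n"
  shows "Lp_pow p (blk (fejer_err_coeff n c) k)
    \<le> real B powr p * (1 + fejer_const * real B)
      * ((1 / 2) powr p) ^ (N - k) * (real (M k) powr (1 - 2 * p) * Lp_pow p (blk c k))"
proof -
  define q where "q = min n (M (Suc k))"
  let ?b = "\<lambda>i. of_nat (min i q) / of_nat q * c i"
  let ?E = "(1 + fejer_const * real B) * (real (M k) powr (1 - 2 * p) * Lp_pow p (blk c k))"
  have kN: "M k \<le> M N" using assms(1) by (rule M_mono)
  then have q: "M k \<le> q" "q \<le> M (Suc k)" and n: "0 < n" "0 < q"
    using assms(2) M_pos[of k] M_mono[of k "Suc k"] by (auto simp: q_def)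
  have "blk (fejer_err_coeff n c) k = (\<lambda>x. - (of_nat q / of_nat n) * blk ?b k x)"
  proof
    fix x
    have *: "fejer_err_coeff n c i = - (of_nat q / of_nat n) * ?b i" if "i \<in> {M k..<M (Suc k)}" for i
    proof -
      have "min i n = min i q" using that by (auto simp: q_def)
      then show ?thesis using n by (simp add: fejer_err_coeff_def)
    qed
    show "blk (fejer_err_coeff n c) k x = - (of_nat q / of_nat n) * blk ?b k x"
      unfolding blk_def sum_distrib_left by (intro sum.cong refl) (simp only: * mult.assoc)
  qed
  then have "Lp_pow p (blk (fejer_err_coeff n c) k) = (real q / real n) powr p * Lp_pow p (blk ?b k)"
    by (simp only: Lp_pow_cmult) (simp add: norm_divide)
  also have "\<dots> \<le> (real B * (1 / 2) ^ (N - k)) powr p * ?E"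
  proof (intro mult_mono Lp_pow_blk_multiplier_le q powr_mono2)
    have "real (2 ^ (N - k) * M k) \<le> real (M (k + (N - k)))"
      using M_add_ge[of "N - k" k] by (simp only: of_nat_le_iff)
    also have "k + (N - k) = N" using assms by simp
    also have "real (M N) \<le> real n" using assms by simp
    finally have 2: "2 ^ (N - k) * real (M k) \<le> real n" by simp
    have "real q \<le> real (B * M k)"
      using q(2) M_Suc_le[of k] by (simp only: of_nat_le_iff)
    then have "real q / real n \<le> real B * real (M k) / real n"
      using n by (intro divide_right_mono) auto
    also have "\<dots> \<le> real B * real (M k) / (2 ^ (N - k) * real (M k))"
      using 2 M_pos[of k] n by (intro divide_left_mono mult_pos_pos) auto
    also have "\<dots> = real B * (1 / 2) ^ (N - k)"
      using M_pos[of k] by (simp add: power_one_over)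
    finally show "real q / real n \<le> real B * (1 / 2) ^ (N - k)" .
  qed (use p_pos in \<open>auto simp: Lp_pow_nonneg\<close>)
  also have "(real B * (1 / 2) ^ (N - k)) powr p = real B powr p * ((1 / 2) powr p) ^ (N - k)"
    by (simp add: powr_mult powr_realpow[symmetric] powr_powr mult.commute)
  finally show ?thesis by (simp only: mult_ac)
qed

text \<open>All multipliers from index \<open>n\<close> on are \<open>- 1\<close>. As
  \<open>n \<le> M (Suc N)\<close>, beyond the first \<open>Suc N\<close> blocks the error is minus
  the tail of the martingale itself, with the same maximal function.\<close>

lemma Hp_pow_fejer_err_le:
  assumes "M N < n" "n \<le> M (Suc N)"
  shows "Hp_pow p (trig (fejer_err_coeff n c)) \<le> ennreal (real B powr p * (1 + fejer_const * real B)
    * (\<Sum>k<Suc N. ((1 / 2) powr p) ^ (N - k) * (real (M k) powr (1 - 2 * p) * Lp_pow p (blk c k))))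
    + Hp_pow p (trig (tail (Suc N) c))"
proof -
  have "cmod (trig (tail (Suc N) (fejer_err_coeff n c)) k x) = cmod (trig (tail (Suc N) c) k x)" for k x
  proof -
    have "tail (Suc N) (fejer_err_coeff n c) i = - tail (Suc N) c i" for i
    proof (cases "i < M (Suc N)")
      case False
      with assms have "min i n = n" "0 < n" by auto
      then show ?thesis using False by (simp add: tail_def fejer_err_coeff_def)
    qed (simp add: tail_def)
    then show ?thesis by (simp add: trig_def sum_negf)
  qed
  then have tl: "Hp_pow p (trig (tail (Suc N) (fejer_err_coeff n c))) = Hp_pow p (trig (tail (Suc N) c))"
    by (rule Hp_pow_cong_cmod)
  have "Hp_pow p (trig (fejer_err_coeff n c)) \<le> ennreal (\<Sum>k<Suc N. Lp_pow p (blk (fejer_err_coeff n c) k))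
      + Hp_pow p (trig (tail (Suc N) (fejer_err_coeff n c)))"
    using p_pos p_less by (intro Hp_pow_le_blocks_tail) (auto simp: fejer_err_coeff_def)
  also have "\<dots> \<le> ennreal (real B powr p * (1 + fejer_const * real B)
    * (\<Sum>k<Suc N. ((1 / 2) powr p) ^ (N - k) * (real (M k) powr (1 - 2 * p) * Lp_pow p (blk c k))))
    + Hp_pow p (trig (tail (Suc N) c))"
    unfolding tl sum_distrib_left
  proof (intro add_right_mono ennreal_leI sum_mono)
    fix k assume "k \<in> {..<Suc N}"
    then have "k \<le> N" by simp
    from Lp_pow_blk_fejer_err_le[OF this less_imp_le[OF assms(1)], of c]
    show "Lp_pow p (blk (fejer_err_coeff n c) k) \<le> real B powr p * (1 + fejer_const * real B)
      * (((1 / 2) powr p) ^ (N - k) * (real (M k) powr (1 - 2 * p) * Lp_pow p (blk c k)))"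
      by (simp only: mult.assoc)
  qed
  finally show ?thesis .
qed

lemma ex_M_bracket:
  assumes "2 \<le> n"
  obtains N where "M N < n" "n \<le> M (Suc N)"
proof -
  define N where "N = (LEAST N. n \<le> M (Suc N))"
  have "n \<le> M (Suc n)" using vil_M_gt[OF m_all, of "Suc n"] by simp
  then have 1: "n \<le> M (Suc N)" unfolding N_def by (rule LeastI)
  have "M N < n"
  proof (cases N)
    case 0
    with assms show ?thesis by (simp add: vil_M_simps)
  next
    case (Suc K)
    then show ?thesis using not_less_Least[of K "\<lambda>N. n \<le> M (Suc N)"] by (simp add: N_def)
  qed
  with 1 that show thesis by blast
qed

section \<open>Convergence of the Fejer means under the little-o condition\<close>

theorem fejer_means_converge:
  assumes mart: "is_martingale m f"
    and o: "enn_smallo (\<lambda>n. Hp_modulus m p n f) (\<lambda>n. 1 / real (M n) powr (1 / p - 2))"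
  shows "(\<lambda>n. Hp_norm m p (fejer_error m n f)) \<longlonglongrightarrow> 0"
proof -
  define c where "c = mart_coeff m f"
  have f: "f k x = trig c k x" if "x \<in> G" for k x
    unfolding c_def using martingale_eq_trig[OF mart that] .
  \<comment> \<open>Raising to the power \<open>p\<close> turns the rate
    \<open>1 / M n powr (1 / p - 2)\<close> into \<open>M n powr (2 * p - 1)\<close>.\<close>
  have tail_le: "eventually (\<lambda>n. Hp_pow p (trig (tail n c)) \<le> ennreal (e * real (M n) powr (2 * p - 1))) sequentially"
    if e: "0 < e" for e
  proof -
    have "eventually (\<lambda>n. Hp_modulus m p n f \<le> ennreal (e powr (1 / p) * \<bar>1 / real (M n) powr (1 / p - 2)\<bar>)) sequentially"
      using o e unfolding enn_smallo_def by simp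
    then show ?thesis
    proof eventually_elim
      case (elim n)
      have "e powr (1 / p) * \<bar>1 / real (M n) powr (1 / p - 2)\<bar> = (e * real (M n) powr (2 * p - 1)) powr (1 / p)"
      proof -
        have "(2 * p - 1) * (1 / p) = - (1 / p - 2)" using p_pos by (simp add: field_simps)
        then show ?thesis using e by (simp add: powr_mult powr_powr powr_minus_divide del: minus_diff_eq)
      qed
      with elim have "ennreal_powr (Hp_pow p (trig (tail n c))) (1 / p)
          \<le> ennreal_powr (ennreal (e * real (M n) powr (2 * p - 1))) (1 / p)"
        using e by (simp add: Hp_modulus_eq[of f c, OF f] Hp_norm_eq ennreal_powr_ennreal)
      then show ?case
        using p_pos by (simp add: ennreal_powr_le_iff ennreal_powr_powr_inverse)
    qed
  qed
  \<comment> \<open>The weight is the one in \<open>Lp_pow_blk_fejer_err_le\<close>, and it cancels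
    the rate \<open>M k powr (2 * p - 1)\<close> of the tails; hence the little-o condition makes
    the sequence null.\<close>
  define \<epsilon> where "\<epsilon> k = real (M k) powr (1 - 2 * p) * Lp_pow p (blk c k)" for k
  have eps: "\<epsilon> \<longlonglongrightarrow> 0"
  proof (rule tendstoI)
    fix e :: real assume e: "0 < e"
    from tail_le[of "e / 2"] e
    have "eventually (\<lambda>n. Hp_pow p (trig (tail n c)) \<le> ennreal (e / 2 * real (M n) powr (2 * p - 1))) sequentially"
      by simp
    then show "eventually (\<lambda>n. dist (\<epsilon> n) 0 < e) sequentially"
    proof eventually_elim
      case (elim n)
      with Lp_pow_blk_le_Hp_pow[OF p_pos, of c n]
      have "ennreal (Lp_pow p (blk c n)) \<le> ennreal (e / 2 * real (M n) powr (2 * p - 1))"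
        by (rule order_trans)
      then have "Lp_pow p (blk c n) \<le> e / 2 * real (M n) powr (2 * p - 1)"
        using e by (simp add: ennreal_le_iff)
      then have "\<epsilon> n \<le> real (M n) powr (1 - 2 * p) * (e / 2 * real (M n) powr (2 * p - 1))"
        unfolding \<epsilon>_def by (rule mult_left_mono) simp
      also have "\<dots> = e / 2 * (real (M n) powr (1 - 2 * p) * real (M n) powr (2 * p - 1))" by simp
      also have "real (M n) powr (1 - 2 * p) * real (M n) powr (2 * p - 1) = 1"
        unfolding powr_add[symmetric] using M_pos[of n] by simp
      finally show ?case using e by (simp add: \<epsilon>_def Lp_pow_nonneg)
    qed
  qed
  define C where "C = real B powr p * (1 + fejer_const * real B)"
  \<comment> \<open>The bound for the first \<open>Suc N\<close> blocks of the error: a null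
    sequence convolved with a geometric one of ratio \<open>(1 / 2) powr p\<close>.\<close>
  define a where "a N = C * (\<Sum>k<Suc N. ((1 / 2) powr p) ^ (N - k) * \<epsilon> k)" for N
  have "((1 :: real) / 2) powr p < (1 / 2) powr 0"
    using p_pos by (intro powr_less_mono') auto
  then have "a \<longlonglongrightarrow> C * 0"
    unfolding a_def by (intro tendsto_mult tendsto_const tendsto_0_geometric_convolution eps) auto
  then have a: "a \<longlonglongrightarrow> 0" by simp
  have main: "eventually (\<lambda>n. Hp_pow p (trig (fejer_err_coeff n c)) \<le> ennreal e) sequentially" if e: "0 < e" for e
  proof -
    have "eventually (\<lambda>N. a N < e / 2) sequentially"
      using order_tendstoD(2)[OF a, of "e / 2"] e by simp
    moreover have "eventually (\<lambda>N. Hp_pow p (trig (tail (Suc N) c)) \<le> ennreal (e / 2)) sequentially"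
    proof -
      have "eventually (\<lambda>n. Hp_pow p (trig (tail n c)) \<le> ennreal (e / 2 * real (M n) powr (2 * p - 1))) sequentially"
        using e by (intro tail_le) simp
      then have "eventually (\<lambda>n. Hp_pow p (trig (tail n c)) \<le> ennreal (e / 2)) sequentially"
      proof eventually_elim
        case (elim n)
        have "real (M n) powr (2 * p - 1) \<le> real (M n) powr 0"
          using M_ge_1[of n] p_less by (intro powr_mono) auto
        then have "real (M n) powr (2 * p - 1) \<le> 1" using M_pos[of n] by simp
        then have "e / 2 * real (M n) powr (2 * p - 1) \<le> e / 2 * 1"
          using e by (intro mult_left_mono) auto
        then have "ennreal (e / 2 * real (M n) powr (2 * p - 1)) \<le> ennreal (e / 2)"
          by (intro ennreal_leI) simp
        with elim show ?case by (rule order_trans)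
      qed
      then show ?thesis using eventually_sequentially_Suc[of "\<lambda>n. Hp_pow p (trig (tail n c)) \<le> ennreal (e / 2)"] by simp
    qed
    ultimately have "eventually (\<lambda>N. a N < e / 2 \<and> Hp_pow p (trig (tail (Suc N) c)) \<le> ennreal (e / 2)) sequentially"
      by (rule eventually_conj)
    then obtain K where K: "\<And>N. K \<le> N \<Longrightarrow> a N < e / 2 \<and> Hp_pow p (trig (tail (Suc N) c)) \<le> ennreal (e / 2)"
      unfolding eventually_sequentially by blast
    show ?thesis
    proof (rule eventually_sequentiallyI)
      \<comment> \<open>The summand 2 allows \<open>n\<close> to be bracketed, and
        \<open>n > M K\<close> forces the bracketing level to be at least \<open>K\<close>.\<close>
      fix n assume n: "M K + 2 \<le> n"
      then have "2 \<le> n" by simp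
      then obtain N where N: "M N < n" "n \<le> M (Suc N)" by (rule ex_M_bracket)
      have "K \<le> N"
      proof (rule ccontr)
        assume "\<not> K \<le> N"
        then have "M (Suc N) \<le> M K" by (intro M_mono) simp
        with n N show False by simp
      qed
      note K = K[OF this]
      have "Hp_pow p (trig (fejer_err_coeff n c)) \<le> ennreal (a N) + Hp_pow p (trig (tail (Suc N) c))"
        using Hp_pow_fejer_err_le[OF N, of c] unfolding a_def C_def \<epsilon>_def .
      also have "\<dots> \<le> ennreal (e / 2) + ennreal (e / 2)"
        using K by (intro add_mono ennreal_leI) auto
      also have "\<dots> = ennreal e" using e by (simp add: ennreal_plus[symmetric] del: ennreal_plus)
      finally show "Hp_pow p (trig (fejer_err_coeff n c)) \<le> ennreal e" .
    qed
  qed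
  show ?thesis
  proof (rule ennreal_tendsto_0I)
    fix e :: real assume e: "0 < e"
    then have "eventually (\<lambda>n. Hp_pow p (trig (fejer_err_coeff n c)) \<le> ennreal (e powr p)) sequentially"
      by (intro main) simp
    moreover have "eventually (\<lambda>n. 0 < n) sequentially" by (rule eventually_gt_at_top)
    ultimately show "eventually (\<lambda>n. Hp_norm m p (fejer_error m n f) \<le> ennreal e) sequentially"
    proof eventually_elim
      case (elim n)
      have "Hp_norm m p (fejer_error m n f) = Hp_norm m p (trig (fejer_err_coeff n c))"
        by (intro Hp_norm_cong fejer_error_eq f elim)
      also have "\<dots> \<le> ennreal e"
        using elim e p_pos by (simp add: Hp_norm_eq ennreal_powr_le_iff ennreal_powr_ennreal)
      finally show ?case .
    qed
  qed
qed

section \<open>Sharpness: a martingale whose Fejer means do not converge in weak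
  \<open>L_p\<close>\<close>

text \<open>For positive \<open>i\<close>, \<open>LEAST\<close> picks the block containing
  \<open>i\<close>. With these coefficients block \<open>k\<close> is \<open>M k\<close> times the
  difference of the Dirichlet kernels of orders \<open>M (Suc k)\<close> and
  \<open>M k\<close>.\<close>

definition extremal_coeff :: "nat \<Rightarrow> complex" where
  "extremal_coeff i = (if i = 0 then 0 else of_nat (M (LEAST k. i < M (Suc k))))"

lemma extremal_coeff_eq:
  assumes "M k \<le> i" "i < M (Suc k)"
  shows "extremal_coeff i = of_nat (M k)"
proof -
  have "(LEAST k. i < M (Suc k)) = k"
  proof (rule Least_equality)
    fix j assume "i < M (Suc j)"
    show "k \<le> j"
    proof (rule ccontr)
      assume "\<not> k \<le> j"
      then have "M (Suc j) \<le> M k" by (intro M_mono) simp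
      with \<open>i < M (Suc j)\<close> assms show False by simp
    qed
  qed (rule assms)
  then show ?thesis using assms M_pos[of k] by (simp add: extremal_coeff_def)
qed

abbreviation "origin \<equiv> (\<lambda>_. 0 :: nat)"

lemma origin_in_G: "origin \<in> G"
  by (auto simp: vil_group_def m_pos)

lemma psi_origin: "\<psi> i origin = 1"
  by (simp add: vil_psi_finite[OF m_all] rademacher_def)

text \<open>Both Dirichlet kernels vanish off the coset of the origin of level \<open>k\<close>, and
  on it their difference is at most \<open>B * M k\<close>.\<close>

lemma blk_extremal_coeff_le:
  assumes "x \<in> G"
  shows "cmod (blk extremal_coeff k x) \<le> real B * dirichlet_bd k origin x"
proof -
  have D: "(\<Sum>i<M n. \<psi> i x) = (if \<forall>j<n. x j = 0 then of_nat (M n) else 0)" for n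
    using dirichlet_kernel[OF assms origin_in_G, of n] by (simp add: psi_origin)
  have "blk extremal_coeff k x = (\<Sum>i\<in>{M k..<M (Suc k)}. of_nat (M k) * \<psi> i x)"
    unfolding blk_def by (intro sum.cong refl) (simp add: extremal_coeff_eq)
  also have "\<dots> = of_nat (M k) * ((\<Sum>i<M (Suc k). \<psi> i x) - (\<Sum>i<M k. \<psi> i x))"
    using M_mono[of k "Suc k"] sum_diff_nat_ivl[of 0 "M k" "M (Suc k)" "\<lambda>i. \<psi> i x"]
    by (simp add: sum_distrib_left lessThan_atLeast0)
  finally have *: "cmod (blk extremal_coeff k x)
      = real (M k) * cmod ((\<Sum>i<M (Suc k). \<psi> i x) - (\<Sum>i<M k. \<psi> i x))"
    by (simp add: norm_mult)
  show ?thesis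
  proof (cases "\<forall>j<k. x j = 0")
    case True
    have "cmod ((\<Sum>i<M (Suc k). \<psi> i x) - (\<Sum>i<M k. \<psi> i x)) \<le> real (B * M k)"
    proof (cases "\<forall>j<Suc k. x j = 0")
      case T: True
      have "cmod ((\<Sum>i<M (Suc k). \<psi> i x) - (\<Sum>i<M k. \<psi> i x)) = real (M (Suc k) - M k)"
        unfolding D if_P[OF T] if_P[OF True] using M_mono[of k "Suc k"]
        by (metis le_SucI of_nat_diff norm_of_nat order_refl)
      also have "\<dots> \<le> real (B * M k)" using M_Suc_le[of k] by (subst of_nat_le_iff) simp
      finally show ?thesis .
    next
      case F: False
      have "cmod ((\<Sum>i<M (Suc k). \<psi> i x) - (\<Sum>i<M k. \<psi> i x)) = real (M k)"
        unfolding D if_not_P[OF F] if_P[OF True] by simp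
      also have "\<dots> \<le> real (B * M k)" using B_ge_2 by (subst of_nat_le_iff) simp
      finally show ?thesis .
    qed
    then have "real (M k) * cmod ((\<Sum>i<M (Suc k). \<psi> i x) - (\<Sum>i<M k. \<psi> i x)) \<le> real (M k) * real (B * M k)"
      by (rule mult_left_mono) simp
    also have "\<dots> = real B * dirichlet_bd k origin x"
      unfolding dirichlet_bd_def if_P[OF True] by (simp add: power2_eq_square mult_ac)
    finally show ?thesis unfolding * .
  next
    case False
    then have F: "\<not> (\<forall>j<Suc k. x j = 0)" using less_SucI by blast
    show ?thesis
      unfolding * D dirichlet_bd_def if_not_P[OF False] if_not_P[OF F] by simp
  qed
qed

lemma Lp_pow_blk_extremal_coeff_le: "Lp_pow p (blk extremal_coeff k) \<le> real B powr p * real (M k) powr (2 * p - 1)"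
proof -
  have intd: "integrable \<mu> (\<lambda>x. dirichlet_bd k origin x powr p)"
    by (rule integrable_level[OF level_compose[OF level_dirichlet_bd]])
  have "Lp_pow p (blk extremal_coeff k) \<le> (LINT x|\<mu>. real B powr p * dirichlet_bd k origin x powr p)"
    unfolding Lp_pow_def
  proof (rule integral_mono)
    show "integrable \<mu> (\<lambda>x. cmod (blk extremal_coeff k x) powr p)"
      by (rule integrable_level[OF level_compose[OF level_blk]])
    fix x assume "x \<in> space \<mu>"
    then have "cmod (blk extremal_coeff k x) powr p \<le> (real B * dirichlet_bd k origin x) powr p"
      using p_pos by (intro powr_mono2 blk_extremal_coeff_le) (auto simp: space_vil_haar)
    then show "cmod (blk extremal_coeff k x) powr p \<le> real B powr p * dirichlet_bd k origin x powr p"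
      by (simp add: powr_mult)
  qed (use intd in simp)
  also have "\<dots> = real B powr p * real (M k) powr (2 * p - 1)"
    by (simp add: integral_dirichlet_bd[OF origin_in_G])
  finally show ?thesis .
qed

text \<open>From level \<open>n\<close> on, the \<open>p\<close>-th powers of the blocks are
  dominated by a geometric series of ratio \<open>theta\<close> whose first term is a multiple of
  \<open>M n powr (2 * p - 1)\<close>.\<close>

lemma Hp_pow_tail_extremal_coeff_le:
  "Hp_pow p (trig (tail n extremal_coeff)) \<le> ennreal (real B powr p / (1 - theta) * real (M n) powr (2 * p - 1))"
proof -
  define g where "g k = (if k < n then 0 else real B powr p * real (M n) powr (2 * p - 1) * theta ^ (k - n))" for k
  have le: "Lp_pow p (blk (tail n extremal_coeff) k) \<le> g k" for k
  proof (cases "k < n")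
    case True
    then show ?thesis by (simp add: g_def Lp_pow_def blk_tail)
  next
    case False
    then have "k = n + (k - n)" by simp
    then have "real (M k) powr (2 * p - 1) \<le> real (M n) powr (2 * p - 1) * theta ^ (k - n)"
      using M_powr_le[of n "k - n"] by simp
    then have "real B powr p * real (M k) powr (2 * p - 1)
        \<le> real B powr p * (real (M n) powr (2 * p - 1) * theta ^ (k - n))"
      by (rule mult_left_mono) simp
    with Lp_pow_blk_extremal_coeff_le[of k] False show ?thesis
      by (simp add: g_def Lp_pow_def blk_tail mult.assoc)
  qed
  have g0: "0 \<le> g k" for k using theta by (simp add: g_def)
  have "(\<lambda>k. theta ^ k) sums (1 / (1 - theta))"
    using theta by (intro geometric_sums) simp
  from sums_mult[OF this, of "real B powr p * real (M n) powr (2 * p - 1)"]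
  have "(\<lambda>k. g (k + n)) sums (real B powr p * real (M n) powr (2 * p - 1) * (1 / (1 - theta)))"
    by (simp add: g_def)
  then have "g sums (real B powr p * real (M n) powr (2 * p - 1) * (1 / (1 - theta)))"
    using sums_iff_shift[of g n] by (simp add: g_def)
  then have sums: "g sums (real B powr p / (1 - theta) * real (M n) powr (2 * p - 1))"
    by simp
  have "Hp_pow p (trig (tail n extremal_coeff)) \<le> (\<Sum>k. ennreal (Lp_pow p (blk (tail n extremal_coeff) k)))"
    using p_pos p_less by (intro Hp_pow_le_suminf tail_0) auto
  also have "\<dots> \<le> (\<Sum>k. ennreal (g k))"
    using le by (intro suminf_le ennreal_leI) auto
  also have "\<dots> = ennreal (real B powr p / (1 - theta) * real (M n) powr (2 * p - 1))"
    using g0 sums by (rule suminf_ennreal_eq)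
  finally show ?thesis .
qed

lemma Hp_norm_tail_extremal_le:
  "Hp_norm m p (trig (tail n extremal_coeff))
    \<le> ennreal ((real B powr p / (1 - theta)) powr (1 / p) * \<bar>1 / real (M n) powr (1 / p - 2)\<bar>)"
proof -
  have "(2 * p - 1) * (1 / p) = - (1 / p - 2)" using p_pos by (simp add: field_simps)
  then have "(real B powr p / (1 - theta) * real (M n) powr (2 * p - 1)) powr (1 / p)
      = (real B powr p / (1 - theta)) powr (1 / p) * \<bar>1 / real (M n) powr (1 / p - 2)\<bar>"
    unfolding powr_mult[of "_ / _"] powr_powr
    by (simp only: powr_minus_divide abs_of_nonneg zero_le_divide_1_iff powr_ge_zero)
  moreover have "Hp_norm m p (trig (tail n extremal_coeff))
      \<le> ennreal_powr (ennreal (real B powr p / (1 - theta) * real (M n) powr (2 * p - 1))) (1 / p)"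
    unfolding Hp_norm_eq using p_pos by (intro ennreal_powr_mono Hp_pow_tail_extremal_coeff_le) auto
  ultimately show ?thesis
    using theta by (simp only: ennreal_powr_ennreal mult_nonneg_nonneg divide_nonneg_nonneg powr_ge_zero diff_ge_0_iff_ge less_imp_le)
qed

lemma trig_extremal_in_Hp: "trig extremal_coeff \<in> Hp m p"
proof -
  \<comment> \<open>Level 0 cuts off only index 0, where the coefficient vanishes anyway, so the
    tail estimate there bounds the whole norm.\<close>
  have "tail 0 extremal_coeff = extremal_coeff"
    by (simp add: fun_eq_iff tail_def vil_M_simps extremal_coeff_def)
  with Hp_norm_tail_extremal_le[of 0] have "Hp_norm m p (trig extremal_coeff) < \<infinity>"
    by (simp add: le_less_trans)
  then show ?thesis by (simp add: Hp_def martingale_trig)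
qed

text \<open>Multiplied by their orders, the error coefficients for \<open>M N + 1\<close> and
  \<open>M N\<close> differ by \<open>- extremal_coeff i\<close> for \<open>i > M N\<close> and not
  at all otherwise. Up to level \<open>Suc N\<close> this is minus block \<open>N\<close> with its
  first term added back; the block vanishes off the coset of the origin and the first term has
  modulus \<open>M N\<close>.\<close>

lemma fejer_errors_off_origin:
  assumes "x \<in> G" "x \<notin> vil_interval m N origin"
  shows "real (M N) \<le> real (M N + 1) * cmod (trig (fejer_err_coeff (M N + 1) extremal_coeff) (Suc N) x)
    + real (M N) * cmod (trig (fejer_err_coeff (M N) extremal_coeff) (Suc N) x)"
proof -
  let ?E = "\<lambda>n. trig (fejer_err_coeff n extremal_coeff) (Suc N) x"
  have lt: "M N < M (Suc N)" using M_Suc_ge[of N] M_pos[of N] by simp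
  have coeff: "of_nat (M N + 1) * fejer_err_coeff (M N + 1) extremal_coeff i - of_nat (M N) * fejer_err_coeff (M N) extremal_coeff i
      = (if i = M N then extremal_coeff i else 0) - tail N extremal_coeff i" for i
  proof -
    have n: "of_nat n * fejer_err_coeff n extremal_coeff i = - (of_nat (min i n) * extremal_coeff i)" if "0 < n" for n
      using that by (simp add: fejer_err_coeff_def)
    have "of_nat (M N + 1) * fejer_err_coeff (M N + 1) extremal_coeff i - of_nat (M N) * fejer_err_coeff (M N) extremal_coeff i
        = (of_nat (min i (M N)) - of_nat (min i (M N + 1))) * extremal_coeff i"
      using n[of "M N + 1"] n[of "M N"] M_pos[of N] by (simp only: left_diff_distrib) simp
    also have "\<dots> = (if i = M N then extremal_coeff i else 0) - tail N extremal_coeff i"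
    proof (cases "i \<le> M N")
      case True
      then have "min i (M N) = i" "min i (M N + 1) = i" by auto
      with True show ?thesis by (auto simp: tail_def)
    next
      case False
      then have "min i (M N) = M N" "min i (M N + 1) = M N + 1" by auto
      with False show ?thesis by (simp add: tail_def)
    qed
    finally show ?thesis .
  qed
  have "of_nat (M N + 1) * ?E (M N + 1) - of_nat (M N) * ?E (M N)
      = (\<Sum>i<M (Suc N). (of_nat (M N + 1) * fejer_err_coeff (M N + 1) extremal_coeff i
          - of_nat (M N) * fejer_err_coeff (M N) extremal_coeff i) * \<psi> i x)"
    unfolding trig_def sum_distrib_left sum_subtractf[symmetric] left_diff_distrib mult.assoc ..
  also have "\<dots> = (\<Sum>i<M (Suc N). (if i = M N then extremal_coeff i * \<psi> i x else 0)) - blk extremal_coeff N x"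
    unfolding coeff blk_eq_trig trig_def sum_subtractf[symmetric]
    by (intro sum.cong refl) (simp add: left_diff_distrib)
  also have "blk extremal_coeff N x = 0"
  proof -
    have "\<not> (\<forall>k<N. x k = origin k)" using assms by (auto simp: vil_interval_def)
    then have "dirichlet_bd N origin x = 0" unfolding dirichlet_bd_def by (rule if_not_P)
    with blk_extremal_coeff_le[OF assms(1), of N] show ?thesis by simp
  qed
  also have "(\<Sum>i<M (Suc N). (if i = M N then extremal_coeff i * \<psi> i x else 0)) - 0 = of_nat (M N) * \<psi> (M N) x"
    using lt by (simp add: extremal_coeff_eq[of N])
  finally have "real (M N) = cmod (of_nat (M N + 1) * ?E (M N + 1) - of_nat (M N) * ?E (M N))"
    by (simp add: norm_mult cmod_psi)
  also have "\<dots> \<le> real (M N + 1) * cmod (?E (M N + 1)) + real (M N) * cmod (?E (M N))"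
    using norm_triangle_ineq4[of "of_nat (M N + 1) * ?E (M N + 1)" "of_nat (M N) * ?E (M N)"]
    by (simp only: norm_mult norm_of_nat)
  finally show ?thesis .
qed

text \<open>If both errors were at most \<open>1 / 4\<close> at a point off the coset, then
  \<open>M N \<le> (2 * M N + 1) / 4\<close>, which is false. So two exceptional sets, each of
  measure below \<open>1 / 4\<close>, and a coset of measure at most \<open>1 / 2\<close> would
  cover the group.\<close>

lemma fejer_errors_extremal_not_null:
  "\<not> (\<lambda>n. mart_weak_Lp_norm m p (fejer_error m n (trig extremal_coeff))) \<longlonglongrightarrow> 0"
proof
  let ?E = "\<lambda>n. trig (fejer_err_coeff n extremal_coeff)"
  let ?W = "\<lambda>n. mart_weak_Lp_norm m p (fejer_error m n (trig extremal_coeff))"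
  let ?A = "\<lambda>n k. {x \<in> space \<mu>. 1 / 4 < cmod (?E n k x)}"
  assume lim: "?W \<longlonglongrightarrow> 0"
  \<comment> \<open>The least weak norm of a function that exceeds \<open>1 / 4\<close> in modulus
    on a set of measure at least \<open>1 / 4\<close>, as the choice \<open>l = 1 / 4\<close> in the
    supremum shows.\<close>
  define \<delta> where "\<delta> = 1 / 4 * (1 / 4) powr (1 / p)"
  have "0 < ennreal \<delta>" by (simp add: \<delta>_def)
  with lim have "eventually (\<lambda>n. ?W n < ennreal \<delta>) sequentially"
    by (rule order_tendstoD(2))
  then obtain n0 where n0: "\<And>n. n0 \<le> n \<Longrightarrow> ?W n < ennreal \<delta>"
    unfolding eventually_sequentially by blast
  have small: "measure \<mu> (?A n k) < 1 / 4" if "n0 \<le> n" "0 < n" for n k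
  proof (rule ccontr)
    assume "\<not> measure \<mu> (?A n k) < 1 / 4"
    then have ge: "ennreal (1 / 4) \<le> emeasure \<mu> (?A n k)"
      by (simp add: finite_measure.emeasure_eq_measure[OF finite_measure_haar] ennreal_leI)
    have "ennreal \<delta> = ennreal (1 / 4) * ennreal_powr (ennreal (1 / 4)) (1 / p)"
      unfolding \<delta>_def by (subst ennreal_mult) (simp_all only: ennreal_powr_ennreal, simp_all)
    also have "\<dots> \<le> ennreal (1 / 4) * ennreal_powr (emeasure \<mu> (?A n k)) (1 / p)"
      using p_pos ge by (intro mult_left_mono ennreal_powr_mono) auto
    also have "\<dots> \<le> weak_Lp_norm m p (?E n k)"
      unfolding weak_Lp_norm_def by (rule SUP_upper) simp
    also have "\<dots> = weak_Lp_norm m p (fejer_error m n (trig extremal_coeff) k)"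
      by (rule weak_Lp_norm_cong) (simp add: fejer_error_eq that)
    also have "\<dots> \<le> ?W n"
      unfolding mart_weak_Lp_norm_def by (rule SUP_upper) simp
    finally show False using n0[OF that(1)] by simp
  qed
  \<comment> \<open>The increment ensures \<open>2 \<le> M N\<close> even for \<open>n0 = 0\<close>,
    which bounds the measure of the coset by \<open>1 / 2\<close>.\<close>
  define N where "N = n0 + 1"
  have MN: "n0 \<le> M N" "2 \<le> M N"
    using vil_M_gt[OF m_all, of N] by (auto simp: N_def)
  let ?A1 = "?A (M N + 1) (Suc N)" and ?A2 = "?A (M N) (Suc N)" and ?I = "vil_interval m N origin"
  have "space \<mu> \<subseteq> ?A1 \<union> ?A2 \<union> ?I"
  proof
    fix x assume x: "x \<in> space \<mu>"
    show "x \<in> ?A1 \<union> ?A2 \<union> ?I"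
    proof (rule ccontr)
      assume "x \<notin> ?A1 \<union> ?A2 \<union> ?I"
      with x have le: "cmod (?E (M N + 1) (Suc N) x) \<le> 1 / 4" "cmod (?E (M N) (Suc N) x) \<le> 1 / 4"
        and "x \<in> G" "x \<notin> ?I" by (auto simp: space_vil_haar)
      then have "real (M N) \<le> real (M N + 1) * cmod (?E (M N + 1) (Suc N) x) + real (M N) * cmod (?E (M N) (Suc N) x)"
        by (intro fejer_errors_off_origin)
      also have "\<dots> \<le> real (M N + 1) * (1 / 4) + real (M N) * (1 / 4)"
        using le by (intro add_mono mult_left_mono) auto
      also have "\<dots> < real (M N)" using MN by (simp add: field_simps)
      finally show False by simp
    qed
  qed
  moreover have sets: "?A n k \<in> sets \<mu>" for n k
    using level_borel_measurable[OF level_trig] by measurable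
  moreover have I: "?I \<in> sets \<mu>" by (rule vil_interval_in_sets)
  ultimately have "measure \<mu> (space \<mu>) \<le> measure \<mu> (?A1 \<union> ?A2 \<union> ?I)"
    by (intro finite_measure.finite_measure_mono[OF finite_measure_haar] sets.Un)
  also have "\<dots> \<le> measure \<mu> (?A1 \<union> ?A2) + measure \<mu> ?I"
    by (intro measure_Un_le sets.Un sets I)
  also have "measure \<mu> (?A1 \<union> ?A2) \<le> measure \<mu> ?A1 + measure \<mu> ?A2"
    by (intro measure_Un_le sets)
  also have "measure \<mu> ?A1 + measure \<mu> ?A2 + measure \<mu> ?I < 1"
  proof -
    have "measure \<mu> ?I \<le> 1 / 2"
      using MN by (simp add: measure_interval[OF origin_in_G] field_simps)
    moreover have "measure \<mu> ?A1 < 1 / 4" by (rule small) (use MN in auto)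
    moreover have "measure \<mu> ?A2 < 1 / 4" by (rule small) (use MN in auto)
    ultimately show ?thesis by linarith
  qed
  finally show False
    using prob_space.prob_space[OF prob_space_vil_haar[OF m_all]] by simp
qed

theorem fejer_means_counterexample:
  "trig extremal_coeff \<in> Hp m p"
  "enn_bigo (\<lambda>n. Hp_modulus m p n (trig extremal_coeff)) (\<lambda>n. 1 / real (M n) powr (1 / p - 2))"
  "\<not> (\<lambda>n. mart_weak_Lp_norm m p (fejer_error m n (trig extremal_coeff))) \<longlonglongrightarrow> 0"
proof -
  have "Hp_modulus m p n (trig extremal_coeff) = Hp_norm m p (trig (tail n extremal_coeff))" for n
    by (rule Hp_modulus_eq) (rule refl)
  moreover have "0 < (real B powr p / (1 - theta)) powr (1 / p)"
    using theta B_ge_2 by simp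
  ultimately show "enn_bigo (\<lambda>n. Hp_modulus m p n (trig extremal_coeff)) (\<lambda>n. 1 / real (M n) powr (1 / p - 2))"
    unfolding enn_bigo_def using Hp_norm_tail_extremal_le
    by (intro exI[of _ "(real B powr p / (1 - theta)) powr (1 / p)"]) simp
qed (rule trig_extremal_in_Hp fejer_errors_extremal_not_null)+

end

theorem theorem3p23:
  fixes m :: "nat \<Rightarrow> nat" and p :: real
  assumes "\<forall>k. 2 \<le> m k" and "bdd_above (range m)"
    and "0 < p" and "p < 1 / 2"
  shows "(\<forall>f\<in>Hp m p.
            enn_smallo (\<lambda>n. Hp_modulus m p n f) (\<lambda>n. 1 / real (vil_M m n) powr (1 / p - 2)) \<longrightarrow>
            (\<lambda>n. Hp_norm m p (fejer_error m n f)) \<longlonglongrightarrow> 0)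
       \<and> (\<exists>f\<in>Hp m p.
            enn_bigo (\<lambda>n. Hp_modulus m p n f) (\<lambda>n. 1 / real (vil_M m n) powr (1 / p - 2)) \<and>
            \<not> (\<lambda>n. mart_weak_Lp_norm m p (fejer_error m n f)) \<longlonglongrightarrow> 0)"
proof -
  obtain B where "m k \<le> B" for k
    using assms(2) by (auto simp: bdd_above_def)
  then interpret vilenkin_p m B p
    using assms by unfold_locales auto
  show ?thesis
  proof (intro conjI ballI impI)
    fix f assume "f \<in> Hp m p"
    then have "is_martingale m f" by (simp add: Hp_def)
    moreover assume "enn_smallo (\<lambda>n. Hp_modulus m p n f) (\<lambda>n. 1 / real (vil_M m n) powr (1 / p - 2))"
    ultimately show "(\<lambda>n. Hp_norm m p (fejer_error m n f)) \<longlonglongrightarrow> 0"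
      by (rule fejer_means_converge)
  qed (use fejer_means_counterexample in blast)
qed

end
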